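(* Let $G$ be a finite group. If $\Pr(G) \in \{\frac{5}{14}, \frac{2}{5}, \frac{11}{27}, \frac{1}{2}, \frac{5}{8}\}$, then the non-commuting graph $\mathcal{A}_G$ is L-integral.
   Context: For a finite group $G$, $\Pr(G) = |\{(x,y) \in G \times G : xy = yx\}|/|G|^2$ is the commuting probability, i.e. the probability that two randomly chosen elements of $G$ commute. For a finite non-abelian group $G$ with centre $Z(G)$, the non-commuting graph $\mathcal{A}_G$ is the simple undirected graph with vertex set $G \setminus Z(G)$ in which two vertices $x,y$ are adjacent if and only if $xy \neq yx$. A finite graph is L-integral if all eigenvalues of its Laplacian matrix $D - A$ ($D$ the degree matrix, $A$ the adjacency matrix) are integers. *)

theory Defs
  imports
    "HOL-Algebra.Group"
    "Graph_Theory.Pair_Digraph"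
    "Jordan_Normal_Form.Char_Poly"
begin

definition commuting_probability :: "('a, 'b) monoid_scheme \<Rightarrow> real" where
  "commuting_probability G =
     real (card {(x, y) \<in> carrier G \<times> carrier G. x \<otimes>\<^bsub>G\<^esub> y = y \<otimes>\<^bsub>G\<^esub> x}) / (real (card (carrier G)))\<^sup>2"

definition group_centre :: "('a, 'b) monoid_scheme \<Rightarrow> 'a set" where
  "group_centre G = {z \<in> carrier G. \<forall>x\<in>carrier G. z \<otimes>\<^bsub>G\<^esub> x = x \<otimes>\<^bsub>G\<^esub> z}"

text \<open>A finite simple undirected graph is a \<^locale>\<open>pair_graph\<close>: every edge between
  \<open>x\<close> and \<open>y\<close> is present as the two arcs \<open>(x, y)\<close> and \<open>(y, x)\<close>, so that
  \<^const>\<open>out_degree\<close> is the degree.\<close>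

definition non_commuting_graph :: "('a, 'b) monoid_scheme \<Rightarrow> 'a pair_pre_digraph" where
  "non_commuting_graph G =
     \<lparr> pverts = carrier G - group_centre G,
       parcs = {(x, y). x \<in> carrier G - group_centre G \<and> y \<in> carrier G - group_centre G \<and>
                        x \<otimes>\<^bsub>G\<^esub> y \<noteq> y \<otimes>\<^bsub>G\<^esub> x} \<rparr>"

lemma pair_graph_non_commuting_graph:
  assumes "finite (carrier G)"
  shows "pair_graph (non_commuting_graph G)"
proof -
  have "parcs (non_commuting_graph G) \<subseteq> carrier G \<times> carrier G"
    by (auto simp: non_commuting_graph_def)
  then have "finite (parcs (non_commuting_graph G))"
    using assms by (meson finite_SigmaI finite_subset)
  then show ?thesis
    using assms
    by unfold_locales (auto simp: non_commuting_graph_def symmetric_def intro!: symI)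
qed

text \<open>The matrices of a graph are taken with respect to a list \<open>vs\<close> enumerating the vertices
  without repetition.\<close>

definition adjacency_matrix :: "'a pair_pre_digraph \<Rightarrow> 'a list \<Rightarrow> complex mat" where
  "adjacency_matrix \<Gamma> vs =
     mat (length vs) (length vs) (\<lambda>(i, j). if (vs ! i, vs ! j) \<in> parcs \<Gamma> then 1 else 0)"

definition degree_matrix :: "'a pair_pre_digraph \<Rightarrow> 'a list \<Rightarrow> complex mat" where
  "degree_matrix \<Gamma> vs =
     mat (length vs) (length vs)
       (\<lambda>(i, j). if i = j then of_nat (out_degree (with_proj \<Gamma>) (vs ! i)) else 0)"

definition laplacian_matrix :: "'a pair_pre_digraph \<Rightarrow> 'a list \<Rightarrow> complex mat" where
  "laplacian_matrix \<Gamma> vs = degree_matrix \<Gamma> vs - adjacency_matrix \<Gamma> vs"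

text \<open>Different enumerations give matrices conjugate under a permutation matrix, so the
  quantifier over \<open>vs\<close> only expresses that the choice is irrelevant; \<^locale>\<open>pair_graph\<close>
  makes the vertex set finite, so that an enumeration exists.\<close>

definition L_integral :: "'a pair_pre_digraph \<Rightarrow> bool" where
  "L_integral \<Gamma> \<longleftrightarrow> pair_graph \<Gamma> \<and>
     (\<forall>vs. distinct vs \<and> set vs = pverts \<Gamma> \<longrightarrow>
        (\<forall>\<mu>. eigenvalue (laplacian_matrix \<Gamma> vs) \<mu> \<longrightarrow> \<mu> \<in> \<int>))"

end

(*
  Weigh an element x by |C(x)|/|G|; the weights sum to Pr(G)|G|, and the weight is 1 on the centre,
  1/2 on elements whose centralizer has index two, and at most 1/3 elsewhere.  As every value in
  the list exceeds 1/3, either [G : Z(G)] is small, and then it must be 9, or there is an x with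
  centralizer H of index two.  If such an H is abelian, or if [G : Z(G)] = 9, then centralizers of
  non-central elements are abelian, so the non-commuting graph is complete multipartite and its
  Laplacian eigenvalues are integers.  Otherwise [G : Z(G)] >= 16, whereas the values 5/8 and 1/2
  force [G : Z(G)] <= 9.  For the other values put A = Z(H).  Every g outside H satisfies
  [A : Z(G)] | [G : C(g)], which bounds Pr(G) from above and forces [A : Z(G)] to be small.  On the
  other hand, Pr(G) [G : Z(G)]^2 is an integer, so that 5, 7 or 9 divides [G : Z(G)]; since the
  elements with centralizer of index two commute modulo Z(G) and have small order there, they are
  then too few for Pr(G) to reach the prescribed value.
*)

theory Submission
  imports Defs "HOL-Algebra.Sylow" "HOL-Algebra.Multiplicative_Group"
    "HOL-Algebra.SndIsomorphismGrp"
begin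

section \<open>Laplacians of complete multipartite graphs\<close>

text \<open>Non-adjacency is an equivalence relation on \<open>V\<close> whose classes
  \<open>K x\<close> are the parts. Summing the eigenvalue equation over a part expresses the part
  sum through the total \<open>S\<close>, and summing over \<open>V\<close> gives
  \<open>\<mu> * S = 0\<close>. Only 0, |V| and |V| - |K x0| remain for \<mu>.\<close>

lemma complete_multipartite_eigenvalue:
  fixes f :: "'v \<Rightarrow> complex" and E :: "'v \<Rightarrow> 'v \<Rightarrow> bool"
  assumes fin: "finite V"
    and irrefl: "\<And>x. x \<in> V \<Longrightarrow> \<not> E x x"
    and sym: "\<And>x y. E x y \<Longrightarrow> E y x"
    and trans: "\<And>x y z. \<lbrakk>x \<in> V; y \<in> V; z \<in> V; \<not> E x y; \<not> E y z\<rbrakk> \<Longrightarrow> \<not> E x z"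
    and eigen: "\<And>x. x \<in> V \<Longrightarrow>
      of_nat (card {y \<in> V. E x y}) * f x - (\<Sum>y \<in> {y \<in> V. E x y}. f y) = \<mu> * f x"
    and x0: "x0 \<in> V" "f x0 \<noteq> 0"
  shows "\<mu> \<in> \<int>"
proof -
  define S where "S = (\<Sum>y\<in>V. f y)"
  define K where "K x = {y \<in> V. \<not> E x y}" for x
  have finK: "finite (K x)" and KV: "K x \<subseteq> V" for x
    using fin by (auto simp: K_def)
  have nbr: "{y \<in> V. E x y} = V - K x" for x
    by (auto simp: K_def)
  have K_eq: "K y = K x" if "x \<in> V" "y \<in> K x" for x y
  proof -
    have "y \<in> V" "\<not> E x y" "\<not> E y x" using that sym by (auto simp: K_def)
    then show ?thesis
      unfolding K_def using that(1) trans by blast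
  qed
  have eq1: "(of_nat (card V) - of_nat (card (K x)) - \<mu>) * f x = S - sum f (K x)" if "x \<in> V" for x
  proof -
    have "card (V - K x) = card V - card (K x)" "card (K x) \<le> card V"
      using fin finK KV by (simp_all add: card_Diff_subset card_mono)
    then have "of_nat (card (V - K x)) = (of_nat (card V) - of_nat (card (K x)) :: complex)"
      by (simp add: of_nat_diff)
    moreover have "sum f (V - K x) = S - sum f (K x)"
      unfolding S_def using fin KV by (simp add: sum_diff)
    ultimately have h: "(of_nat (card V) - of_nat (card (K x))) * f x = \<mu> * f x + (S - sum f (K x))"
      using eigen[OF that] unfolding nbr by (simp only: diff_eq_eq)
    show ?thesis
      unfolding left_diff_distrib[of "of_nat (card V) - of_nat (card (K x))" \<mu>] h by simp
  qed
  have eq2: "(of_nat (card V) - \<mu>) * sum f (K x) = of_nat (card (K x)) * S" if x: "x \<in> V" for x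
  proof -
    have "(of_nat (card V) - of_nat (card (K x)) - \<mu>) * sum f (K x) =
        (\<Sum>y\<in>K x. (of_nat (card V) - of_nat (card (K y)) - \<mu>) * f y)"
      unfolding sum_distrib_left using K_eq[OF x] by (intro sum.cong) auto
    also have "\<dots> = (\<Sum>y\<in>K x. S - sum f (K x))"
    proof (intro sum.cong refl)
      fix y assume y: "y \<in> K x"
      then show "(of_nat (card V) - of_nat (card (K y)) - \<mu>) * f y = S - sum f (K x)"
        using eq1[of y] KV K_eq[OF x y] by auto
    qed
    finally show ?thesis by (simp add: algebra_simps)
  qed
  \<comment> \<open>By symmetry of \<open>E\<close>, each \<open>f y\<close> is counted once per
    neighbour of y, so the Laplacian has vanishing column sums.\<close>
  have "(\<Sum>x\<in>V. \<Sum>y \<in> {y \<in> V. E x y}. f y) = (\<Sum>y\<in>V. \<Sum>x \<in> {x \<in> V. E x y}. f y)"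
    using sum.swap_restrict[OF fin fin, of "\<lambda>x y. f y" E] .
  also have "\<dots> = (\<Sum>y\<in>V. of_nat (card {x \<in> V. E y x}) * f y)"
  proof -
    have "{x \<in> V. E x y} = {x \<in> V. E y x}" for y using sym by auto
    then show ?thesis by simp
  qed
  finally have "(\<Sum>x\<in>V. \<mu> * f x) = 0"
    using eigen by (simp add: sum_subtractf flip: eigen)
  then have "\<mu> * S = 0"
    by (simp add: S_def sum_distrib_left)
  then consider "\<mu> = 0" | "S = 0" by auto
  then show ?thesis
  proof cases
    case 2
    show ?thesis
    proof (cases "\<mu> = of_nat (card V)")
      case False
      then have "sum f (K x0) = 0"
        using eq2[OF x0(1)] 2 by simp
      then have "\<mu> = of_nat (card V) - of_nat (card (K x0))"
        using eq1[OF x0(1)] 2 x0(2) by simp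
      then show ?thesis by simp
    qed simp
  qed simp
qed

text \<open>An eigenvector of the matrix is read as a function on vertices, for which its eigenvalue
  equation is the Laplacian equation treated above.\<close>

lemma L_integral_complete_multipartite:
  assumes "pair_graph \<Gamma>"
    and trans: "\<And>x y z. \<lbrakk>x \<in> pverts \<Gamma>; y \<in> pverts \<Gamma>; z \<in> pverts \<Gamma>;
      (x, y) \<notin> parcs \<Gamma>; (y, z) \<notin> parcs \<Gamma>\<rbrakk> \<Longrightarrow> (x, z) \<notin> parcs \<Gamma>"
  shows "L_integral \<Gamma>"
  unfolding L_integral_def
proof (intro conjI allI impI)
  fix vs \<mu>
  assume vs: "distinct vs \<and> set vs = pverts \<Gamma>" and ev: "eigenvalue (laplacian_matrix \<Gamma> vs) \<mu>"
  interpret pair_graph \<Gamma> by fact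
  let ?n = "length vs" and ?V = "pverts \<Gamma>" and ?E = "\<lambda>x y. (x, y) \<in> parcs \<Gamma>"
  obtain v where v: "v \<in> carrier_vec ?n" "v \<noteq> 0\<^sub>v ?n" "laplacian_matrix \<Gamma> vs *\<^sub>v v = \<mu> \<cdot>\<^sub>v v"
    using ev by (auto simp: eigenvalue_def eigenvector_def laplacian_matrix_def
        adjacency_matrix_def degree_matrix_def)
  \<comment> \<open>The coordinate of v at the position of x, which is unique because
    \<open>vs\<close> has no repetitions.\<close>
  define f where "f x = v $ (THE i. i < ?n \<and> vs ! i = x)" for x
  have f_nth: "f (vs ! i) = v $ i" if "i < ?n" for i
  proof -
    have "(THE j. j < ?n \<and> vs ! j = vs ! i) = i"
      using that vs nth_eq_iff_index_eq by blast
    then show ?thesis by (simp add: f_def)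
  qed
  have bij: "bij_betw ((!) vs) {..<?n} ?V"
    using vs bij_betw_nth by blast
  have deg: "out_degree (with_proj \<Gamma>) x = card {y \<in> ?V. ?E x y}" for x
  proof -
    have "out_arcs (with_proj \<Gamma>) x = Pair x ` {y \<in> ?V. ?E x y}"
      using in_arcsD2 by (fastforce simp: out_arcs_def)
    then show ?thesis
      by (simp add: out_degree_def card_image inj_on_def)
  qed
  show "\<mu> \<in> \<int>"
  proof -
    obtain i0 where i0: "i0 < ?n" "v $ i0 \<noteq> 0"
      using v(1,2) by (metis carrier_vecD eq_vecI index_zero_vec)
    have eigen: "of_nat (card {y \<in> ?V. ?E x y}) * f x - (\<Sum>y \<in> {y \<in> ?V. ?E x y}. f y) = \<mu> * f x"
      if x: "x \<in> ?V" for x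
    proof -
      obtain i where i: "i < ?n" "x = vs ! i"
        using x vs by (metis in_set_conv_nth)
      let ?d = "of_nat (card {y \<in> ?V. ?E x y}) :: complex"
      have "\<mu> * f x = (laplacian_matrix \<Gamma> vs *\<^sub>v v) $ i"
        using v i f_nth by simp
      also have "\<dots> = (\<Sum>j<?n. ((if i = j then ?d else 0) - (if ?E x (vs ! j) then 1 else 0)) * v $ j)"
        using v(1) i by (simp add: laplacian_matrix_def adjacency_matrix_def degree_matrix_def
            scalar_prod_def deg atLeast0LessThan cong: if_cong)
      also have "\<dots> = (\<Sum>j<?n. (if i = j then ?d * v $ j else 0)) -
          (\<Sum>j<?n. (if ?E x (vs ! j) then f (vs ! j) else 0))"
        unfolding sum_subtractf[symmetric] using f_nth by (intro sum.cong) (auto simp: algebra_simps)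
      also have "(\<Sum>j<?n. (if i = j then ?d * v $ j else 0)) = ?d * f x"
        using i f_nth by (simp add: sum.delta)
      also have "(\<Sum>j<?n. (if ?E x (vs ! j) then f (vs ! j) else 0)) =
          (\<Sum>y\<in>?V. if ?E x y then f y else 0)"
        by (rule sum.reindex_bij_betw[OF bij])
      also have "\<dots> = (\<Sum>y \<in> {y \<in> ?V. ?E x y}. f y)"
        by (simp add: sum.inter_filter)
      finally show ?thesis by simp
    qed
    show ?thesis
    proof (rule complete_multipartite_eigenvalue[OF pair_finite_verts, of ?E])
      show "vs ! i0 \<in> ?V" "f (vs ! i0) \<noteq> 0"
        using vs i0 f_nth nth_mem by auto
      show "\<not> ?E x x" for x
        using pair_no_loops by force
    qed (use trans eigen arcs_symmetric in blast)+
  qed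
qed fact

section \<open>Centralizers and subgroups of index two\<close>

locale finite_group = group +
  assumes finite_carrier [simp, intro]: "finite (carrier G)"
begin

definition centralizer :: "'a \<Rightarrow> 'a set" where
  "centralizer x = {y \<in> carrier G. x \<otimes> y = y \<otimes> x}"

abbreviation Z :: "'a set" where
  "Z \<equiv> group_centre G"

text \<open>The double centralizer of x. Taking it as the centre of the subgroup C(x) allows facts
  about centres of finite groups to be applied inside C(x).\<close>

definition bicentre :: "'a \<Rightarrow> 'a set" where
  "bicentre x = group_centre (G\<lparr>carrier := centralizer x\<rparr>)"

lemma mem_centralizer: "y \<in> centralizer x \<longleftrightarrow> y \<in> carrier G \<and> x \<otimes> y = y \<otimes> x"
  by (simp add: centralizer_def)

lemma mem_centre: "z \<in> Z \<longleftrightarrow> z \<in> carrier G \<and> (\<forall>x\<in>carrier G. z \<otimes> x = x \<otimes> z)"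
  by (simp add: group_centre_def)

lemma mem_bicentre:
  "a \<in> bicentre x \<longleftrightarrow> a \<in> centralizer x \<and> (\<forall>y\<in>centralizer x. a \<otimes> y = y \<otimes> a)"
  by (simp add: bicentre_def group_centre_def)

lemma finite_subset_carrier: "A \<subseteq> carrier G \<Longrightarrow> finite A"
  using finite_subset by blast

section \<open>Commutation, centralizers and orders of subgroups\<close>

lemma inv_mult_cancel [simp]:
  assumes "x \<in> carrier G" "y \<in> carrier G"
  shows "inv x \<otimes> (x \<otimes> y) = y" "x \<otimes> (inv x \<otimes> y) = y"
  using assms by (simp_all add: m_assoc[symmetric])

lemma commute_inv:
  assumes "x \<in> carrier G" "y \<in> carrier G" "x \<otimes> y = y \<otimes> x"
  shows "x \<otimes> inv y = inv y \<otimes> x"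
  using assms by (metis inv_closed inv_solve_left inv_solve_right m_assoc m_closed)

lemma commute_mult:
  assumes "x \<in> carrier G" "y \<in> carrier G" "z \<in> carrier G" "x \<otimes> y = y \<otimes> x" "x \<otimes> z = z \<otimes> x"
  shows "x \<otimes> (y \<otimes> z) = (y \<otimes> z) \<otimes> x"
  using assms by (metis m_assoc)

text \<open>An arbitrary set S is allowed so that centralizers, the centre and bicentres are all
  instances.\<close>

lemma subgroup_commutant:
  assumes "S \<subseteq> carrier G"
  shows "subgroup {y \<in> carrier G. \<forall>s\<in>S. s \<otimes> y = y \<otimes> s} G"
proof (rule subgroupI)
  show "{y \<in> carrier G. \<forall>s\<in>S. s \<otimes> y = y \<otimes> s} \<noteq> {}"
    using assms by (auto intro!: exI[of _ \<one>])
qed (use assms in \<open>auto intro!: commute_inv commute_mult\<close>)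

lemma subgroup_centralizer: "x \<in> carrier G \<Longrightarrow> subgroup (centralizer x) G"
  using subgroup_commutant[of "{x}"] by (simp add: centralizer_def)

lemma subgroup_centre: "subgroup Z G"
proof -
  have "Z = {y \<in> carrier G. \<forall>s\<in>carrier G. s \<otimes> y = y \<otimes> s}"
    by (auto simp: mem_centre)
  then show ?thesis using subgroup_commutant[of "carrier G"] by simp
qed

lemma normal_centre: "Z \<lhd> G"
proof -
  have "x \<otimes> z \<otimes> inv x = z" if "x \<in> carrier G" "z \<in> Z" for x z
    using that by (metis inv_solve_right m_closed mem_centre)
  then show ?thesis by (simp add: normal_inv_iff subgroup_centre)
qed

lemma centralizer_subset: "centralizer x \<subseteq> carrier G"
  by (auto simp: mem_centralizer)

lemma centre_subset: "Z \<subseteq> carrier G"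
  by (auto simp: mem_centre)

lemma centre_subset_centralizer: "x \<in> carrier G \<Longrightarrow> Z \<subseteq> centralizer x"
  by (auto simp: mem_centralizer mem_centre)

lemma self_centralizer: "x \<in> carrier G \<Longrightarrow> x \<in> centralizer x"
  by (simp add: mem_centralizer)

lemma centralizer_sym:
  "\<lbrakk>x \<in> carrier G; y \<in> centralizer x\<rbrakk> \<Longrightarrow> x \<in> centralizer y"
  by (simp add: mem_centralizer)

lemma mem_centre_iff_centralizer: "x \<in> carrier G \<Longrightarrow> x \<in> Z \<longleftrightarrow> centralizer x = carrier G"
  by (auto simp: mem_centralizer mem_centre)

lemma card_subgroup_pos: "subgroup H G \<Longrightarrow> 0 < card H"
  by (simp add: subgroup.finite_imp_card_positive)

lemma card_subgroup_dvd_order: "subgroup H G \<Longrightarrow> card H dvd order G"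
  by (metis dvd_triv_right lagrange)

lemma finite_group_subgroup:
  assumes "subgroup H G" shows "finite_group (G\<lparr>carrier := H\<rparr>)"
  using assms subgroup.subgroup_is_group[OF assms group_axioms] finite_subset_carrier[OF subgroup.subset]
  by (simp add: finite_group_def finite_group_axioms_def)

lemma card_subgroup_dvd:
  assumes "subgroup H G" "subgroup K G" "K \<subseteq> H"
  shows "card K dvd card H"
proof -
  interpret H: finite_group "G\<lparr>carrier := H\<rparr>" by (rule finite_group_subgroup) fact
  have "subgroup K (G\<lparr>carrier := H\<rparr>)" using assms by (intro subgroup_incl)
  from H.card_subgroup_dvd_order[OF this] show ?thesis by (simp add: order_def)
qed

lemma card_psubset_subgroup:
  assumes "subgroup H G" "subgroup K G" "K \<subset> H"
  obtains l where "card H = l * card K" "2 \<le> l"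
proof -
  have "card K < card H"
    using assms by (intro psubset_card_mono finite_subset_carrier) (auto simp: subgroup.subset)
  moreover obtain l where l: "card H = l * card K"
    using card_subgroup_dvd[OF assms(1,2)] assms(3) by (metis dvdE mult.commute psubset_imp_subset)
  ultimately have "2 \<le> l"
    by (cases "l = 0 \<or> l = 1") auto
  with l that show thesis by blast
qed

text \<open>For non-central x the chain Z < C(x) < G is strict at both places: x lies in C(x) but
  not in Z, and C(x) = G would make x central.\<close>

lemma card_centralizer_decomp:
  assumes "x \<in> carrier G" "x \<notin> Z"
  obtains a b where "card (centralizer x) = a * card Z" "order G = b * card (centralizer x)" "2 \<le> a" "2 \<le> b"
proof -
  have 1: "Z \<subset> centralizer x"
    using assms centre_subset_centralizer self_centralizer by blast
  have 2: "centralizer x \<subset> carrier G"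
    using assms centralizer_subset mem_centre_iff_centralizer by blast
  show thesis
    using card_psubset_subgroup[OF subgroup_centralizer subgroup_centre 1]
      card_psubset_subgroup[OF subgroup_self subgroup_centralizer 2] assms that
    by (metis order_def)
qed

section \<open>Subgroups of index two\<close>

lemma subgroup_Int: "\<lbrakk>subgroup H G; subgroup K G\<rbrakk> \<Longrightarrow> subgroup (H \<inter> K) G"
  using subgroups_Inter_pair by blast

text \<open>H and its coset of the inverse of y are disjoint and equally large, so they fill G, and
  z must lie in the coset.\<close>

lemma index_two_mult:
  assumes H: "subgroup H G" "order G = 2 * card H"
    and y: "y \<in> carrier G" "y \<notin> H" and z: "z \<in> carrier G" "z \<notin> H"
  shows "y \<otimes> z \<in> H"
proof -
  let ?yH = "(\<lambda>h. inv y \<otimes> h) ` H"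
  have HG: "H \<subseteq> carrier G" using H(1) by (rule subgroup.subset)
  have fin: "finite H" "finite ?yH" using finite_subset_carrier[OF HG] by auto
  have "card ?yH = card H"
    using HG y by (intro card_image inj_onI) (metis inv_closed Units_eq Units_l_cancel subsetD)
  moreover have "H \<inter> ?yH = {}"
  proof (rule ccontr)
    assume "H \<inter> ?yH \<noteq> {}"
    then obtain h where h: "h \<in> H" "inv y \<otimes> h \<in> H" by auto
    then have "inv y \<otimes> h \<otimes> inv h \<in> H"
      using H(1) by (simp add: subgroup.m_closed subgroup.m_inv_closed)
    then have "inv y \<in> H" using h HG y by (simp add: m_assoc subset_iff)
    then show False using y H(1) by (metis inv_inv subgroup.m_inv_closed)
  qed
  ultimately have "card (H \<union> ?yH) = card (carrier G)"
    using H(2) fin by (simp add: card_Un_disjoint order_def)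
  moreover have "H \<union> ?yH \<subseteq> carrier G" using HG y by auto
  ultimately have "H \<union> ?yH = carrier G" by (intro card_subset_eq) auto
  then obtain h where "h \<in> H" "z = inv y \<otimes> h" using z by blast
  then show ?thesis using HG y by (simp add: m_assoc[symmetric] subset_iff)
qed

text \<open>For g outside H, both \<open>inv g\<close> and \<open>h \<otimes> g\<close> are outside
  H, so their product returns to H.\<close>

lemma index_two_conj:
  assumes H: "subgroup H G" "order G = 2 * card H" and g: "g \<in> carrier G" and h: "h \<in> H"
  shows "inv g \<otimes> h \<otimes> g \<in> H"
proof (cases "g \<in> H")
  case True
  then show ?thesis using H(1) h by (simp add: subgroup.m_closed subgroup.m_inv_closed)
next
  case False
  have hG: "h \<in> carrier G" using H(1) h subgroup.subset by blast
  have "inv g \<notin> H" using False H(1) g by (metis inv_inv subgroup.m_inv_closed)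
  moreover have "h \<otimes> g \<notin> H"
  proof
    assume "h \<otimes> g \<in> H"
    then have "inv h \<otimes> (h \<otimes> g) \<in> H" using H(1) h by (simp add: subgroup.m_closed subgroup.m_inv_closed)
    then show False using False hG g by (simp add: m_assoc[symmetric])
  qed
  ultimately show ?thesis
    using index_two_mult[OF H, of "inv g" "h \<otimes> g"] g hG by (simp add: m_assoc)
qed

lemma index_two_maximal:
  assumes H: "subgroup H G" "order G = 2 * card H" and K: "subgroup K G" "H \<subseteq> K"
    and y: "y \<in> K" "y \<notin> H"
  shows "K = carrier G"
proof -
  obtain l where l: "card K = l * card H" "2 \<le> l"
    using card_psubset_subgroup[OF K(1) H(1)] K y by blast
  have "order G \<le> card K" using l H(2) by simp
  then show ?thesis
    using subgroup.subset[OF K(1)] by (metis card_seteq finite_carrier order_def)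
qed

text \<open>Left multiplication by an element of L outside H maps each of L \<inter> H and L - H
  injectively into the other.\<close>

lemma card_Int_index_two:
  assumes H: "subgroup H G" "order G = 2 * card H" and L: "subgroup L G" "\<not> L \<subseteq> H"
  shows "card L = 2 * card (L \<inter> H)"
proof -
  obtain y where y: "y \<in> L" "y \<notin> H" using L by blast
  have LG: "L \<subseteq> carrier G" using L(1) by (rule subgroup.subset)
  have fin: "finite L" by (rule finite_subset_carrier[OF LG])
  have inj: "inj_on (\<lambda>h. y \<otimes> h) A" if "A \<subseteq> L" for A
    using that LG y by (intro inj_onI) (metis Units_eq Units_l_cancel subsetD)
  have "(\<lambda>h. y \<otimes> h) ` (L \<inter> H) \<subseteq> L - H"
  proof clarify
    fix h assume h: "h \<in> L" "h \<in> H"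
    have "y \<otimes> h \<notin> H"
    proof
      assume "y \<otimes> h \<in> H"
      then have "y \<otimes> h \<otimes> inv h \<in> H" using H(1) h by (simp add: subgroup.m_closed subgroup.m_inv_closed)
      then show False using y h LG by (simp add: m_assoc subset_iff)
    qed
    then show "y \<otimes> h \<in> L - H" using L(1) y h by (simp add: subgroup.m_closed)
  qed
  then have 1: "card (L \<inter> H) \<le> card (L - H)"
    using fin by (intro card_inj_on_le[OF inj]) auto
  have "(\<lambda>h. y \<otimes> h) ` (L - H) \<subseteq> L \<inter> H"
    using index_two_mult[OF H, of y] y LG L(1) by (auto simp: subgroup.m_closed)
  then have 2: "card (L - H) \<le> card (L \<inter> H)"
    using fin by (intro card_inj_on_le[OF inj]) auto
  have "card L = card (L \<inter> H) + card (L - H)"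
    using fin by (metis card_Diff_subset_Int card_mono finite_Int inf_le1 le_add_diff_inverse)
  with 1 2 show ?thesis by simp
qed

section \<open>Bicentres of elements whose centralizer has index two\<close>

lemma bicentre_eq:
  assumes "x \<in> carrier G"
  shows "bicentre x = {y \<in> carrier G. \<forall>s\<in>centralizer x. s \<otimes> y = y \<otimes> s}"
proof (rule Set.set_eqI, rule iffI)
  fix a assume "a \<in> bicentre x"
  then show "a \<in> {y \<in> carrier G. \<forall>s\<in>centralizer x. s \<otimes> y = y \<otimes> s}"
    using centralizer_subset by (auto simp: mem_bicentre)
next
  fix a assume a: "a \<in> {y \<in> carrier G. \<forall>s\<in>centralizer x. s \<otimes> y = y \<otimes> s}"
  then have "a \<in> centralizer x"
    using self_centralizer[OF assms] by (simp add: mem_centralizer)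
  then show "a \<in> bicentre x" using a by (simp add: mem_bicentre)
qed

lemma subgroup_bicentre: "x \<in> carrier G \<Longrightarrow> subgroup (bicentre x) G"
  using subgroup_commutant[OF centralizer_subset] by (simp add: bicentre_eq)

lemma bicentre_subset_centralizer: "bicentre x \<subseteq> centralizer x"
  by (auto simp: mem_bicentre)

lemma bicentre_subset: "bicentre x \<subseteq> carrier G"
  using bicentre_subset_centralizer centralizer_subset by blast

lemma centre_subset_bicentre: "x \<in> carrier G \<Longrightarrow> Z \<subseteq> bicentre x"
  by (auto simp: bicentre_eq mem_centre mem_centralizer)

lemma self_bicentre: "x \<in> carrier G \<Longrightarrow> x \<in> bicentre x"
  by (simp add: mem_bicentre self_centralizer mem_centralizer)

lemma centralizer_subset_centralizer_bicentre:
  "a \<in> bicentre x \<Longrightarrow> centralizer x \<subseteq> centralizer a"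
  using centralizer_subset by (auto simp: mem_bicentre mem_centralizer)

text \<open>C(a) contains C(x), a subgroup of index two and hence maximal; the further element g
  makes C(a) all of G.\<close>

lemma bicentre_central:
  assumes x: "x \<in> carrier G" "order G = 2 * card (centralizer x)"
    and a: "a \<in> bicentre x" and g: "g \<in> carrier G" "g \<notin> centralizer x" "a \<otimes> g = g \<otimes> a"
  shows "a \<in> Z"
proof -
  have aG: "a \<in> carrier G" using a bicentre_subset by blast
  have "centralizer a = carrier G"
    using index_two_maximal[OF subgroup_centralizer[OF x(1)] x(2) subgroup_centralizer[OF aG]
        centralizer_subset_centralizer_bicentre[OF a], of g] g
    by (simp add: mem_centralizer)
  then show ?thesis using aG mem_centre_iff_centralizer by blast
qed

text \<open>The centre of a normal subgroup is normal: s is the conjugate of some t in C(x), and a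
  commutes with t.\<close>

lemma bicentre_conj:
  assumes x: "x \<in> carrier G" "order G = 2 * card (centralizer x)"
    and a: "a \<in> bicentre x" and g: "g \<in> carrier G"
  shows "inv g \<otimes> a \<otimes> g \<in> bicentre x"
proof -
  have aG: "a \<in> carrier G" using a bicentre_subset by blast
  have "s \<otimes> (inv g \<otimes> a \<otimes> g) = (inv g \<otimes> a \<otimes> g) \<otimes> s" if s: "s \<in> centralizer x" for s
  proof -
    have sG: "s \<in> carrier G" using s centralizer_subset by blast
    define t where "t = g \<otimes> s \<otimes> inv g"
    have t: "t \<in> centralizer x"
      using index_two_conj[OF subgroup_centralizer[OF x(1)] x(2), of "inv g" s] g s by (simp add: t_def)
    have tG: "t \<in> carrier G" using t centralizer_subset by blast
    have s_eq: "s = inv g \<otimes> t \<otimes> g"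
      using g sG by (simp add: t_def m_assoc)
    have "s \<otimes> (inv g \<otimes> a \<otimes> g) = inv g \<otimes> (t \<otimes> a) \<otimes> g"
      unfolding s_eq using g tG aG by (simp add: m_assoc)
    also have "t \<otimes> a = a \<otimes> t" using a t by (simp add: mem_bicentre)
    also have "inv g \<otimes> (a \<otimes> t) \<otimes> g = (inv g \<otimes> a \<otimes> g) \<otimes> s"
      unfolding s_eq using g tG aG by (simp add: m_assoc)
    finally show ?thesis .
  qed
  then show ?thesis using x(1) aG g by (simp add: bicentre_eq)
qed

lemma normal_bicentre:
  assumes "x \<in> carrier G" "order G = 2 * card (centralizer x)"
  shows "bicentre x \<lhd> G"
proof -
  have "g \<otimes> a \<otimes> inv g \<in> bicentre x" if "g \<in> carrier G" "a \<in> bicentre x" for g a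
    using bicentre_conj[OF assms that(2), of "inv g"] that(1) by simp
  then show ?thesis using subgroup_bicentre[OF assms(1)] by (simp add: normal_inv_iff)
qed

text \<open>The second isomorphism theorem, NS/N and S/(N \<inter> S) being isomorphic, combined
  with Lagrange on both sides.\<close>

lemma card_normal_set_mult:
  assumes "N \<lhd> G" "subgroup S G"
  shows "card (N <#> S) * card (N \<inter> S) = card N * card S"
proof -
  interpret second_isomorphism_grp N G S
    using assms by (simp add: second_isomorphism_grp_def second_isomorphism_grp_axioms_def)
  interpret S: finite_group "G\<lparr>carrier := S\<rparr>" by (rule finite_group_subgroup) fact
  interpret P: finite_group "G\<lparr>carrier := N <#> S\<rparr>"
    by (rule finite_group_subgroup[OF normal_set_mult_subgroup])
  have "subgroup (N \<inter> S) (G\<lparr>carrier := S\<rparr>)"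
    using subgroup_Int[OF subgroup_axioms assms(2)] assms(2) by (intro subgroup_incl) auto
  from S.lagrange[OF this]
  have S: "order ((G\<lparr>carrier := S\<rparr>) Mod (N \<inter> S)) * card (N \<inter> S) = card S"
    by (simp add: order_def FactGroup_def)
  have "subgroup N (G\<lparr>carrier := N <#> S\<rparr>)"
    using subgroup_axioms normal_set_mult_subgroup H_contained_in_set_mult by (intro subgroup_incl)
  from P.lagrange[OF this]
  have P: "order ((G\<lparr>carrier := N <#> S\<rparr>) Mod N) * card N = card (N <#> S)"
    by (simp add: order_def FactGroup_def)
  show ?thesis
    unfolding S[symmetric] P[symmetric] iso_same_order[OF normal_intersection_quotient_isom] by simp
qed

text \<open>The bicentre of x is normal and meets C(g) exactly in Z, because g lies outside C(x).
  Their product is therefore a subgroup of order m |C(g)|, which divides |G|.\<close>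

lemma index_centralizer_outside:
  assumes x: "x \<in> carrier G" "order G = 2 * card (centralizer x)"
    and m: "card (bicentre x) = m * card Z"
    and g: "g \<in> carrier G" "g \<notin> centralizer x"
  obtains l where "order G = l * m * card (centralizer g)"
proof -
  note A = normal_bicentre[OF x]
  note C = subgroup_centralizer[OF g(1)]
  have "bicentre x \<inter> centralizer g \<subseteq> Z"
    using bicentre_central[OF x _ g] by (auto simp: mem_centralizer)
  then have int: "bicentre x \<inter> centralizer g = Z"
    using centre_subset_bicentre[OF x(1)] centre_subset_centralizer[OF g(1)] by blast
  have "card (bicentre x <#> centralizer g) * card Z = m * card (centralizer g) * card Z"
    using card_normal_set_mult[OF A C] int m by auto
  then have "card (bicentre x <#> centralizer g) = m * card (centralizer g)"
    using card_subgroup_pos[OF subgroup_centre] by (simp only: mult_right_cancel[OF less_not_refl2])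
  moreover have "subgroup (bicentre x <#> centralizer g) G"
    using A C by (intro second_isomorphism_grp.normal_set_mult_subgroup)
      (simp add: second_isomorphism_grp_def second_isomorphism_grp_axioms_def)
  ultimately have "m * card (centralizer g) dvd order G"
    using card_subgroup_dvd_order by metis
  then obtain l where "order G = m * card (centralizer g) * l" ..
  then show thesis using that[of l] by (simp add: mult_ac)
qed

text \<open>Distinct subgroups of equal order leave some g in C(y) outside C(x). An element of both
  bicentres commutes with this g, hence is central.\<close>

lemma bicentre_Int:
  assumes x: "x \<in> carrier G" "order G = 2 * card (centralizer x)"
    and y: "y \<in> carrier G" "order G = 2 * card (centralizer y)"
    and "centralizer x \<noteq> centralizer y"
  shows "bicentre x \<inter> bicentre y \<subseteq> Z"
proof
  fix a assume a: "a \<in> bicentre x \<inter> bicentre y"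
  have "card (centralizer x) = card (centralizer y)" using x(2) y(2) by simp
  then have "\<not> centralizer y \<subseteq> centralizer x"
    using assms(5) card_subset_eq[OF finite_subset_carrier[OF centralizer_subset]] by metis
  then obtain g where g: "g \<in> centralizer y" "g \<notin> centralizer x" by blast
  show "a \<in> Z"
    using bicentre_central[OF x, of a g] a g centralizer_subset by (auto simp: mem_bicentre)
qed

lemma commute_mod_centre:
  assumes x: "x \<in> carrier G" "x \<in> Z \<or> order G = 2 * card (centralizer x)"
    and y: "y \<in> carrier G" "y \<in> Z \<or> order G = 2 * card (centralizer y)"
  shows "\<exists>c\<in>Z. x \<otimes> y = c \<otimes> (y \<otimes> x)"
proof (cases "x \<otimes> y = y \<otimes> x")
  case True
  then show ?thesis
    using x y subgroup.one_closed[OF subgroup_centre] by (intro bexI[of _ \<one>]) auto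
next
  case False
  then have x2: "order G = 2 * card (centralizer x)" and y2: "order G = 2 * card (centralizer y)"
    using x y by (auto simp: mem_centre)
  \<comment> \<open>The commutator lies in both bicentres, which are normal and meet in the centre.\<close>
  have ne: "centralizer x \<noteq> centralizer y"
    using False self_centralizer[OF y(1)] y(1) by (auto simp: mem_centralizer)
  define c where "c = x \<otimes> y \<otimes> inv x \<otimes> inv y"
  have "y \<otimes> inv x \<otimes> inv y \<in> bicentre x"
    using bicentre_conj[OF x(1) x2, of "inv x" "inv y"] x y self_bicentre[OF x(1)]
      subgroup.m_inv_closed[OF subgroup_bicentre[OF x(1)]] by simp
  then have "x \<otimes> (y \<otimes> inv x \<otimes> inv y) \<in> bicentre x"
    using self_bicentre[OF x(1)] subgroup.m_closed[OF subgroup_bicentre[OF x(1)]] by blast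
  then have 1: "c \<in> bicentre x" using x y by (simp add: c_def m_assoc)
  have "x \<otimes> y \<otimes> inv x \<in> bicentre y"
    using bicentre_conj[OF y(1) y2, of y "inv x"] x y self_bicentre[OF y(1)] by simp
  then have "c \<in> bicentre y"
    using self_bicentre[OF y(1)] subgroup_bicentre[OF y(1)]
    by (simp add: c_def subgroup.m_closed subgroup.m_inv_closed)
  with 1 have "c \<in> Z" using bicentre_Int[OF x(1) x2 y(1) y2 ne] by blast
  moreover have "x \<otimes> y = c \<otimes> (y \<otimes> x)"
    using x y by (simp add: c_def m_assoc)
  ultimately show ?thesis by blast
qed

text \<open>The quotient of the bicentre by Z has order m, so m-th powers are trivial in it.\<close>

lemma bicentre_pow_central:
  assumes x: "x \<in> carrier G" and m: "card (bicentre x) = m * card Z" and a: "a \<in> bicentre x"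
  shows "a [^] m \<in> Z"
proof -
  let ?A = "G\<lparr>carrier := bicentre x\<rparr>"
  interpret A: finite_group ?A by (rule finite_group_subgroup[OF subgroup_bicentre[OF x]])
  have "Z \<lhd> ?A"
    by (rule normal_restrict_supergroup[OF subgroup_bicentre[OF x] normal_centre centre_subset_bicentre[OF x]])
  then interpret N: normal Z ?A .
  interpret Q: group "?A Mod Z" by (rule N.factorgroup_is_group)
  have "order (?A Mod Z) * card Z = m * card Z"
    using A.lagrange[OF N.subgroup_axioms] m by (simp add: order_def FactGroup_def)
  then have ord: "order (?A Mod Z) = m"
    using card_subgroup_pos[OF subgroup_centre] by simp
  have "(Z #>\<^bsub>?A\<^esub> a) [^]\<^bsub>?A Mod Z\<^esub> m = Z"
    using Q.pow_order_eq_1[of "Z #>\<^bsub>?A\<^esub> a"] a ord by (simp add: carrier_FactGroup)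
  then have pow: "Z #> (a [^] m) = Z"
    using N.FactGroup_pow[of a m] a by (simp flip: nat_pow_consistent)
  have "a \<in> carrier G" using a bicentre_subset by blast
  then show ?thesis by (intro coset_join1[OF pow _ subgroup_centre] nat_pow_closed)
qed

section \<open>Commuting sets of bounded exponent\<close>

lemma commuting_exponent_bound:
  assumes E: "E \<subseteq> carrier G" "\<And>e f. \<lbrakk>e \<in> E; f \<in> E\<rbrakk> \<Longrightarrow> e \<otimes> f = f \<otimes> e"
    and k: "\<And>e. e \<in> E \<Longrightarrow> e [^] (k::nat) = \<one>" and d: "coprime d k" "d dvd order G"
  shows "d * card E \<le> order G"
proof -
  \<comment> \<open>Since \<open>E\<close> commutes, its double centralizer is abelian, so its elements with trivial
    \<open>k\<close>-th power form a subgroup; by Cauchy's theorem its order is coprime to \<open>d\<close>.\<close>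
  define T where "T = {t \<in> carrier G. \<forall>e\<in>E. e \<otimes> t = t \<otimes> e}"
  define Y where "Y = {y \<in> carrier G. (\<forall>t\<in>T. t \<otimes> y = y \<otimes> t) \<and> y [^] k = \<one>}"
  have ET: "E \<subseteq> T" using E by (auto simp: T_def)
  have EY: "E \<subseteq> Y" using E k by (auto simp: Y_def T_def)
  have comm: "y \<otimes> z = z \<otimes> y" if "y \<in> Y" "z \<in> Y" for y z
  proof -
    \<comment> \<open>z commutes with all of \<open>T\<close>, in particular with \<open>E\<close>,
      and this is what membership in \<open>T\<close> means.\<close>
    have "z \<in> T" using that(2) ET by (auto simp: Y_def T_def)
    then show ?thesis using that(1) by (auto simp: Y_def)
  qed
  have Y: "subgroup Y G"
  proof (rule subgroupI)
    show "Y \<noteq> {}" by (auto simp: Y_def T_def intro!: exI[of _ \<one>])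
    show "inv a \<in> Y" if "a \<in> Y" for a
      using that by (auto simp: Y_def T_def nat_pow_inv intro!: commute_inv)
    show "a \<otimes> b \<in> Y" if "a \<in> Y" "b \<in> Y" for a b
      using that comm[OF that]
      by (auto simp: Y_def T_def pow_mult_distrib intro!: commute_mult)
  qed (auto simp: Y_def)
  interpret Y: finite_group "G\<lparr>carrier := Y\<rparr>" by (rule finite_group_subgroup[OF Y])
  have "coprime d (card Y)"
  proof (rule ccontr)
    assume "\<not> coprime d (card Y)"
    then obtain p where p: "prime p" "p dvd d" "p dvd card Y"
      by (metis coprime_iff_gcd_eq_1 gcd_greatest_iff prime_factor_nat)
    \<comment> \<open>Exponent one turns Sylow's theorem into Cauchy's; the element y found below
      has order dividing both d and k.\<close>
    then obtain r where "order (G\<lparr>carrier := Y\<rparr>) = p ^ 1 * r" by (auto simp: order_def)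
    from sylow_thm[OF p(1) Y.is_group this Y.finite_carrier]
    obtain P where P: "subgroup P (G\<lparr>carrier := Y\<rparr>)" "card P = p" by auto
    then have PG: "subgroup P G"
      using Y incl_subgroup by blast
    have "P \<noteq> {\<one>}" using P(2) p(1) by auto
    then obtain y where y: "y \<in> P" "y \<noteq> \<one>" using subgroup.one_closed[OF PG] by auto
    interpret P: finite_group "G\<lparr>carrier := P\<rparr>" by (rule finite_group_subgroup[OF PG])
    have yG: "y \<in> carrier G" using y PG by (rule_tac subgroup.mem_carrier)
    have "y [^] p = \<one>"
      using P.pow_order_eq_1[of y] y P(2) by (simp add: order_def flip: nat_pow_consistent)
    moreover have "y [^] k = \<one>"
      using P(1) y subgroup.subset[OF P(1)] by (auto simp: Y_def)
    ultimately have "ord y dvd p" "ord y dvd k" using yG pow_eq_id by blast+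
    then have "ord y dvd d" "ord y dvd k" using p(2) by (auto intro: dvd_trans)
    then have "ord y = 1" using d(1) by (metis coprime_common_divisor_nat)
    then show False using y yG ord_eq_1 by blast
  qed
  \<comment> \<open>Both d and |Y| divide |G|, and coprimality lets them be multiplied.\<close>
  then have "d * card Y dvd order G"
    using d(2) card_subgroup_dvd_order[OF Y] by (simp add: divides_mult)
  moreover have "0 < order G" using order_gt_0_iff_finite by simp
  ultimately have "d * card Y \<le> order G" by (rule dvd_imp_le)
  moreover have "card E \<le> card Y"
    using EY by (intro card_mono) (auto simp: Y_def)
  ultimately show ?thesis by (meson le_trans mult_le_mono2)
qed

text \<open>In G/N the image of \<open>E\<close> commutes and has trivial k-th powers, so the
  previous bound applies there; each coset accounts for at most |N| elements of
  \<open>E\<close>.\<close>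

lemma commuting_exponent_bound_mod:
  assumes N: "N \<lhd> G" and E: "E \<subseteq> carrier G"
    and comm: "\<And>e f. \<lbrakk>e \<in> E; f \<in> E\<rbrakk> \<Longrightarrow> \<exists>c\<in>N. e \<otimes> f = c \<otimes> (f \<otimes> e)"
    and k: "\<And>e. e \<in> E \<Longrightarrow> e [^] (k::nat) \<in> N" and d: "coprime d k" "d * card N dvd order G"
  shows "d * card E \<le> order G"
proof -
  interpret normal N G by fact
  let ?Q = "G Mod N"
  have fQ: "finite (carrier ?Q)" by (simp add: carrier_FactGroup)
  interpret Q: finite_group ?Q
    using factorgroup_is_group fQ by (simp add: finite_group_def finite_group_axioms_def)
  have ordQ: "order ?Q * card N = order G"
    using lagrange[OF subgroup_axioms] by (simp add: order_def FactGroup_def)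
  have pos: "0 < card N" by (rule card_subgroup_pos[OF subgroup_axioms])
  have bnd: "d * card ((\<lambda>e. N #> e) ` E) \<le> order ?Q"
  proof (rule Q.commuting_exponent_bound[OF _ _ _ d(1)])
    show "(\<lambda>e. N #> e) ` E \<subseteq> carrier ?Q" using E by (auto simp: carrier_FactGroup)
    show "d dvd order ?Q" using d(2) pos unfolding ordQ[symmetric] by (auto elim!: dvdE simp: mult_ac)
    show "X \<otimes>\<^bsub>?Q\<^esub> Y = Y \<otimes>\<^bsub>?Q\<^esub> X" if XY: "X \<in> (\<lambda>e. N #> e) ` E" "Y \<in> (\<lambda>e. N #> e) ` E" for X Y
    proof -
      obtain e f where ef: "e \<in> E" "f \<in> E" "X = N #> e" "Y = N #> f" using XY by blast
      then have G: "e \<in> carrier G" "f \<in> carrier G" using E by auto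
      have "e \<otimes> f \<in> N #> (f \<otimes> e)"
        using comm[OF ef(1,2)] by (auto simp: r_coset_def)
      then have "N #> (f \<otimes> e) = N #> (e \<otimes> f)"
        using G by (intro repr_independence subgroup_axioms) auto
      then show ?thesis using ef G by (simp add: rcos_sum)
    qed
    show "X [^]\<^bsub>?Q\<^esub> k = \<one>\<^bsub>?Q\<^esub>" if X: "X \<in> (\<lambda>e. N #> e) ` E" for X
    proof -
      obtain e where e: "e \<in> E" "X = N #> e" using X by blast
      then have "N #> (e [^] k) = N" using k rcos_const group_axioms by blast
      then show ?thesis using e E by (auto simp: FactGroup_pow)
    qed
  qed
  have cover: "card E \<le> card ((\<lambda>e. N #> e) ` E) * card N"
  proof -
    have "card E \<le> card (\<Union>((\<lambda>e. N #> e) ` E))"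
    proof (intro card_mono finite_subset_carrier)
      show "\<Union>((\<lambda>e. N #> e) ` E) \<subseteq> carrier G"
        using E subset by (auto simp: r_coset_def)
      show "E \<subseteq> \<Union>((\<lambda>e. N #> e) ` E)"
        using E rcos_self[OF _ subgroup_axioms] by blast
    qed
    also have "\<dots> \<le> (\<Sum>X\<in>(\<lambda>e. N #> e) ` E. card X)"
      by (rule card_Union_le_sum_card)
    also have "\<dots> = (\<Sum>X\<in>(\<lambda>e. N #> e) ` E. card N)"
    proof (intro sum.cong refl)
      fix X assume "X \<in> (\<lambda>e. N #> e) ` E"
      then have "X \<in> rcosets N" using E by (auto simp: RCOSETS_def)
      then show "card X = card N" using card_rcosets_equal[OF _ subset] by simp
    qed
    finally show ?thesis by simp
  qed
  have "d * card E \<le> d * (card ((\<lambda>e. N #> e) ` E) * card N)"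
    by (rule mult_le_mono2[OF cover])
  also have "\<dots> = d * card ((\<lambda>e. N #> e) ` E) * card N"
    by (simp only: mult.assoc)
  also have "\<dots> \<le> order ?Q * card N"
    by (rule mult_le_mono1[OF bnd])
  finally show ?thesis by (simp only: ordQ)
qed

end

section \<open>Bounds on the commuting probability\<close>

context finite_group
begin

section \<open>Weights and their majorants\<close>

definition index_two_set :: "'a set" where
  "index_two_set = {x \<in> carrier G. order G = 2 * card (centralizer x)}"

definition weight :: "'a \<Rightarrow> real" where
  "weight x = card (centralizer x) / order G"

lemma order_pos: "0 < order G"
  using order_gt_0_iff_finite by simp

lemma commuting_probability_eq: "commuting_probability G * order G = (\<Sum>x\<in>carrier G. weight x)"
proof -
  have "{(x, y) \<in> carrier G \<times> carrier G. x \<otimes> y = y \<otimes> x} = (SIGMA x:carrier G. centralizer x)"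
    by (auto simp: mem_centralizer)
  then have "card {(x, y) \<in> carrier G \<times> carrier G. x \<otimes> y = y \<otimes> x} = (\<Sum>x\<in>carrier G. card (centralizer x))"
    using finite_subset_carrier[OF centralizer_subset] by simp
  then show ?thesis
    using order_pos
    by (simp add: commuting_probability_def weight_def order_def power2_eq_square flip: sum_divide_distrib)
qed

lemma weight_le:
  assumes "k * card (centralizer x) \<le> order G" "0 < k"
  shows "weight x \<le> 1 / k"
proof -
  have "real k * card (centralizer x) \<le> order G"
    using assms(1) by (metis of_nat_le_iff of_nat_mult)
  then show ?thesis using assms(2) order_pos by (simp add: weight_def field_simps)
qed

lemma weight_le_1: "weight x \<le> 1"
  using weight_le[of 1 x] card_mono[OF finite_carrier centralizer_subset] by (simp add: order_def)

lemma weight_noncentral: "x \<in> carrier G \<Longrightarrow> x \<notin> Z \<Longrightarrow> weight x \<le> 1 / 2"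
  using card_centralizer_decomp[of x] weight_le[of 2 x] by (metis mult_le_mono1 of_nat_numeral zero_less_numeral)

lemma weight_index_two: "x \<in> index_two_set \<Longrightarrow> weight x = 1 / 2"
  using order_pos by (simp add: index_two_set_def weight_def)

lemma weight_index_ge_three:
  assumes "x \<in> carrier G" "x \<notin> Z" "x \<notin> index_two_set"
  shows "weight x \<le> 1 / 3"
proof -
  obtain b where b: "order G = b * card (centralizer x)" "2 \<le> b"
    using card_centralizer_decomp[OF assms(1,2)] by blast
  then have "b \<noteq> 2" using assms by (auto simp: index_two_set_def)
  then have "3 * card (centralizer x) \<le> order G" using b by simp
  from weight_le[OF this] show ?thesis by simp
qed

lemma sum_indicator:
  "A \<subseteq> carrier G \<Longrightarrow> (\<Sum>x\<in>carrier G. c * of_bool (x \<in> A)) = c * real (card A)"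
  by (simp add: sum_of_bool_eq inf.absorb2 flip: sum_distrib_left)

lemma index_two_set_subset: "index_two_set \<subseteq> carrier G"
  by (auto simp: index_two_set_def)

text \<open>As in the bounds that follow, the weight is majorized pointwise by a combination of
  indicator functions, which is then summed over G.\<close>

lemma probability_le_centre:
  "commuting_probability G * order G \<le> order G / 2 + card Z / 2"
proof -
  have "weight x \<le> 1/2 + 1/2 * of_bool (x \<in> Z)" if "x \<in> carrier G" for x
    using that weight_noncentral[of x] weight_le_1[of x] by (cases "x \<in> Z") auto
  then have "(\<Sum>x\<in>carrier G. weight x) \<le> (\<Sum>x\<in>carrier G. 1/2 + 1/2 * of_bool (x \<in> Z))"
    by (rule sum_mono)
  also have "\<dots> = order G / 2 + card Z / 2"
    unfolding sum.distrib sum_indicator[OF centre_subset] by (simp add: order_def)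
  finally show ?thesis by (simp only: commuting_probability_eq)
qed

text \<open>The base value 1/3 is raised by 1/6 to reach 1/2 at index two, and by a further 1/2 to
  reach 1 on the centre.\<close>

lemma probability_le_index_two:
  "commuting_probability G * order G \<le>
     order G / 3 + card (Z \<union> index_two_set) / 6 + card Z / 2"
proof -
  let ?E = "Z \<union> index_two_set"
  have E: "?E \<subseteq> carrier G" using centre_subset index_two_set_subset by blast
  have "weight x \<le> 1/3 + 1/6 * of_bool (x \<in> ?E) + 1/2 * of_bool (x \<in> Z)" if "x \<in> carrier G" for x
    using that weight_index_ge_three[of x] weight_index_two[of x] weight_le_1[of x]
    by (cases "x \<in> Z"; cases "x \<in> index_two_set") auto
  then have "(\<Sum>x\<in>carrier G. weight x) \<le>
      (\<Sum>x\<in>carrier G. 1/3 + 1/6 * of_bool (x \<in> ?E) + 1/2 * of_bool (x \<in> Z))"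
    by (rule sum_mono)
  also have "\<dots> = order G / 3 + card ?E / 6 + card Z / 2"
    unfolding sum.distrib sum_indicator[OF centre_subset] sum_indicator[OF E] by (simp add: order_def)
  finally show ?thesis by (simp only: commuting_probability_eq)
qed

lemma probability_le_index_four:
  assumes "index_two_set = {}" "\<And>x. x \<in> carrier G \<Longrightarrow> order G \<noteq> 3 * card (centralizer x)"
  shows "commuting_probability G * order G \<le> order G / 4 + 3 / 4 * card Z"
proof -
  have "weight x \<le> 1/4 + 3/4 * of_bool (x \<in> Z)" if x: "x \<in> carrier G" for x
  proof (cases "x \<in> Z")
    case False
    obtain b where b: "order G = b * card (centralizer x)" "2 \<le> b"
      using card_centralizer_decomp[OF x False] by blast
    then have "b \<noteq> 2" "b \<noteq> 3" using assms x by (auto simp: index_two_set_def)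
    then have "4 * card (centralizer x) \<le> order G" using b by simp
    from weight_le[OF this] False show ?thesis by simp
  qed (use weight_le_1[of x] in simp)
  then have "(\<Sum>x\<in>carrier G. weight x) \<le> (\<Sum>x\<in>carrier G. 1/4 + 3/4 * of_bool (x \<in> Z))"
    by (rule sum_mono)
  also have "\<dots> = order G / 4 + 3 / 4 * card Z"
    unfolding sum.distrib sum_indicator[OF centre_subset] by (simp add: order_def)
  finally show ?thesis by (simp only: commuting_probability_eq)
qed

lemma index_outside_ge:
  assumes x: "x \<in> index_two_set" and m: "card (bicentre x) = m * card Z"
    and g: "g \<in> carrier G" "g \<notin> centralizer x"
  obtains l where "order G = l * m * card (centralizer g)" "1 \<le> l"
proof -
  obtain l where l: "order G = l * m * card (centralizer g)"
    using index_centralizer_outside[OF _ _ m g] x by (auto simp: index_two_set_def)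
  then have "l \<noteq> 0" using order_pos by (metis less_not_refl mult_0)
  with l that[of l] show thesis by simp
qed

text \<open>Non-central elements of C(x) weigh at most 1/2. Outside C(x) the index of a centralizer
  is a multiple of m, so the weight is at most 1/m. Each of the two halves of G is summed
  separately.\<close>

lemma probability_le_bicentre:
  assumes x: "x \<in> index_two_set" and m: "card (bicentre x) = m * card Z" "0 < m"
  shows "commuting_probability G * order G \<le> order G / 4 + order G / (2 * m) + card Z / 2"
proof -
  let ?H = "centralizer x"
  have "weight g \<le> 1/m + (1/2 - 1/m) * of_bool (g \<in> ?H) + 1/2 * of_bool (g \<in> Z)"
    if g: "g \<in> carrier G" for g
  proof (cases "g \<in> ?H")
    case True
    then show ?thesis
      using weight_noncentral[OF g] weight_le_1[of g] by (cases "g \<in> Z") auto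
  next
    case False
    obtain l where "order G = l * m * card (centralizer g)" "1 \<le> l"
      using index_outside_ge[OF x m(1) g False] .
    then have "m * card (centralizer g) \<le> order G" by simp
    from weight_le[OF this m(2)] have "weight g \<le> 1 / m" .
    moreover have "0 \<le> 1/2 * (of_bool (g \<in> Z) :: real)" by simp
    ultimately show ?thesis using False by simp
  qed
  then have "(\<Sum>g\<in>carrier G. weight g) \<le>
      (\<Sum>g\<in>carrier G. 1/m + (1/2 - 1/m) * of_bool (g \<in> ?H) + 1/2 * of_bool (g \<in> Z))"
    by (rule sum_mono)
  also have "\<dots> = order G / m + (1/2 - 1/m) * card ?H + card Z / 2"
    unfolding sum.distrib sum_indicator[OF centre_subset] sum_indicator[OF centralizer_subset]
    by (simp add: order_def)
  also have "real (card ?H) = order G / 2"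
    using x by (simp add: index_two_set_def)
  also have "order G / m + (1/2 - 1/m) * (order G / 2) = order G / 4 + order G / (2 * m)"
    using m(2) by (simp add: field_simps)
  finally show ?thesis by (simp only: commuting_probability_eq)
qed

text \<open>Outside both \<open>?E\<close> and C(x) the index is a multiple of m but not 2. As m is
  neither 1 nor 3, it is not 3 either, which leaves weight at most 1/4. The term 1/12 covers index
  three inside C(x).\<close>

lemma probability_le_bicentre_not_three:
  assumes x: "x \<in> index_two_set" and m: "card (bicentre x) = m * card Z" "2 \<le> m" "m \<noteq> 3"
  shows "commuting_probability G * order G \<le>
    7 / 24 * order G + card (Z \<union> index_two_set) / 4 + card Z / 2"
proof -
  let ?H = "centralizer x" and ?E = "Z \<union> index_two_set"
  have E: "?E \<subseteq> carrier G" using centre_subset index_two_set_subset by blast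
  have "weight g \<le> 1/4 + 1/4 * of_bool (g \<in> ?E) + 1/12 * of_bool (g \<in> ?H) + 1/2 * of_bool (g \<in> Z)"
    if g: "g \<in> carrier G" for g
  proof (cases "g \<in> ?E \<or> g \<in> ?H")
    case True
    then show ?thesis
      using weight_index_ge_three[of g] weight_index_two[of g] weight_le_1[of g] g
      by (cases "g \<in> Z"; cases "g \<in> index_two_set"; cases "g \<in> ?H") auto
  next
    case False
    obtain l where l: "order G = l * m * card (centralizer g)" "1 \<le> l"
      using index_outside_ge[OF x m(1) g] False by blast
    have "l * m \<noteq> 2" using l(1) False g by (auto simp: index_two_set_def)
    moreover have "l * m \<noteq> 3"
    proof
      assume "l * m = 3"
      then have "m dvd 3" by (metis dvd_triv_right)
      then have "m \<le> 3" by (simp add: dvd_imp_le)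
      then have "m = 2" using m by simp
      then show False using \<open>l * m = 3\<close> by presburger
    qed
    moreover have "2 \<le> l * m" using l(2) m(2) by (metis mult_le_mono nat_mult_1)
    ultimately have "4 \<le> l * m" by simp
    then have "4 * card (centralizer g) \<le> order G" unfolding l(1) by (rule mult_le_mono1)
    from weight_le[OF this] False show ?thesis by simp
  qed
  then have "(\<Sum>g\<in>carrier G. weight g) \<le>
      (\<Sum>g\<in>carrier G. 1/4 + 1/4 * of_bool (g \<in> ?E) + 1/12 * of_bool (g \<in> ?H) + 1/2 * of_bool (g \<in> Z))"
    by (rule sum_mono)
  also have "\<dots> = order G / 4 + card ?E / 4 + card ?H / 12 + card Z / 2"
    unfolding sum.distrib sum_indicator[OF centre_subset] sum_indicator[OF centralizer_subset]
      sum_indicator[OF E]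
    by (simp add: order_def)
  also have "real (card ?H) = order G / 2"
    using x by (simp add: index_two_set_def)
  finally show ?thesis by (simp add: commuting_probability_eq)
qed

section \<open>Integrality of the commuting probability and chains of subgroups\<close>

lemma centralizer_centre_mult:
  assumes "z \<in> Z" "g \<in> carrier G"
  shows "centralizer (z \<otimes> g) = centralizer g"
proof -
  have z: "z \<in> carrier G" "\<And>y. y \<in> carrier G \<Longrightarrow> y \<otimes> z = z \<otimes> y"
    using assms(1) by (auto simp: mem_centre)
  have "z \<otimes> g \<otimes> y = y \<otimes> (z \<otimes> g) \<longleftrightarrow> g \<otimes> y = y \<otimes> g" if y: "y \<in> carrier G" for y
  proof -
    have "y \<otimes> (z \<otimes> g) = z \<otimes> (y \<otimes> g)"
      using z(2)[OF y] z(1) y assms(2) by (metis m_assoc)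
    then show ?thesis using z(1) y assms(2) by (simp add: m_assoc)
  qed
  then show ?thesis by (auto simp: mem_centralizer)
qed

text \<open>Centralizers are constant on cosets of Z, so the coset of g contributes |Z| |C(g)|
  commuting pairs, a multiple of |Z|^2. The quotient K is Pr(G) [G : Z]^2.\<close>

lemma probability_integral:
  obtains K :: nat where "commuting_probability G * (order G)\<^sup>2 = K * (card Z)\<^sup>2"
proof -
  have "(\<Sum>x\<in>carrier G. card (centralizer x)) = (\<Sum>X\<in>rcosets Z. \<Sum>x\<in>X. card (centralizer x))"
  proof -
    have "finite X" if "X \<in> rcosets Z" for X
      using that rcosets_part_G[OF subgroup_centre] finite_subset_carrier by blast
    then show ?thesis
      using sum.Union_disjoint[of "rcosets Z" "\<lambda>x. card (centralizer x)"]
        rcos_disjoint[OF subgroup_centre] rcosets_part_G[OF subgroup_centre]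
      by (simp add: pairwise_def disjnt_def)
  qed
  moreover have "(card Z)\<^sup>2 dvd (\<Sum>x\<in>X. card (centralizer x))" if X: "X \<in> rcosets Z" for X
  proof -
    obtain g where g: "g \<in> carrier G" "X = Z #> g" using X by (auto simp: RCOSETS_def)
    have "(\<Sum>x\<in>X. card (centralizer x)) = (\<Sum>x\<in>X. card (centralizer g))"
      using g centralizer_centre_mult by (intro sum.cong) (auto simp: r_coset_def)
    also have "\<dots> = card Z * card (centralizer g)"
      using card_rcosets_equal[OF X centre_subset] by simp
    finally show ?thesis
      using card_subgroup_dvd[OF subgroup_centralizer[OF g(1)] subgroup_centre
          centre_subset_centralizer[OF g(1)]]
      by (simp add: power2_eq_square)
  qed
  ultimately have "(card Z)\<^sup>2 dvd (\<Sum>x\<in>carrier G. card (centralizer x))"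
    by (simp add: dvd_sum)
  then obtain K where K: "(\<Sum>x\<in>carrier G. card (centralizer x)) = (card Z)\<^sup>2 * K" ..
  have "commuting_probability G * (order G)\<^sup>2 = (commuting_probability G * order G) * order G"
    by (simp add: power2_eq_square)
  also have "\<dots> = real (\<Sum>x\<in>carrier G. card (centralizer x))"
    unfolding commuting_probability_eq weight_def using order_pos by (simp flip: sum_divide_distrib)
  also have "\<dots> = K * (card Z)\<^sup>2" unfolding K by simp
  finally show thesis by (rule that)
qed

text \<open>With H = C(x) and y in H not central in H, the chain Z < Z(H) < C_H(y) < H < G is
  strict; its successive indices are m, a, b and 2.\<close>

lemma bicentre_decomp:
  assumes x: "x \<in> index_two_set"
    and nonab: "\<exists>y\<in>centralizer x. \<exists>y'\<in>centralizer x. y \<otimes> y' \<noteq> y' \<otimes> y"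
  obtains m a b where "card (bicentre x) = m * card Z" "order G = 2 * (a * b) * m * card Z"
    "2 \<le> m" "2 \<le> a" "2 \<le> b"
proof -
  have xG: "x \<in> carrier G" and x2: "order G = 2 * card (centralizer x)"
    using x by (auto simp: index_two_set_def)
  have "x \<notin> Z" using x2 mem_centre_iff_centralizer[OF xG] order_pos by (auto simp: order_def)
  then have "Z \<subset> bicentre x" using self_bicentre[OF xG] centre_subset_bicentre[OF xG] by blast
  then obtain m where m: "card (bicentre x) = m * card Z" "2 \<le> m"
    using card_psubset_subgroup[OF subgroup_bicentre[OF xG] subgroup_centre] by blast
  interpret H: finite_group "G\<lparr>carrier := centralizer x\<rparr>"
    by (rule finite_group_subgroup[OF subgroup_centralizer[OF xG]])
  obtain y where y: "y \<in> centralizer x" "y \<notin> bicentre x"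
    using nonab by (auto simp: mem_bicentre)
  obtain a b where ab: "card (H.centralizer y) = a * card (bicentre x)"
    "card (centralizer x) = b * card (H.centralizer y)" "2 \<le> a" "2 \<le> b"
    using H.card_centralizer_decomp[of y] y by (auto simp: bicentre_def order_def)
  show thesis
    using that[OF m(1) _ m(2) ab(3,4)] x2 ab(1,2) m(1) by simp
qed

section \<open>Commuting probability one half\<close>

lemma order_le_if_probability_half:
  assumes P: "commuting_probability G = 1 / 2"
  shows "order G \<le> 9 * card Z"
proof -
  let ?E = "Z \<union> index_two_set"
  have E: "?E \<subseteq> carrier G" using centre_subset index_two_set_subset by blast
  have finE: "finite ?E" using E by (rule finite_subset_carrier)
  \<comment> \<open>At Pr(G) = 1/2 the bound says that at most 3 |Z| elements lie outside
    \<open>?E\<close>.\<close>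
  have "real (order G) \<le> card ?E + 3 * card Z"
    using probability_le_index_two unfolding P by simp
  then have big: "order G \<le> card ?E + 3 * card Z" by linarith
  \<comment> \<open>If \<open>?E\<close> were all of G, the weights would sum to |G|/2 + |Z|/2,
    which exceeds |G|/2.\<close>
  have "\<exists>u\<in>carrier G. u \<notin> ?E"
  proof (rule ccontr)
    assume *: "\<not> ?thesis"
    have "weight x = 1/2 + 1/2 * of_bool (x \<in> Z)" if x: "x \<in> carrier G" for x
    proof (cases "x \<in> Z")
      case True
      then show ?thesis
        using x mem_centre_iff_centralizer[OF x] order_pos by (simp add: weight_def flip: order_def)
    qed (use * x weight_index_two in auto)
    then have "(\<Sum>x\<in>carrier G. weight x) = (\<Sum>x\<in>carrier G. 1/2 + 1/2 * of_bool (x \<in> Z))"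
      by (rule sum.cong[OF refl])
    also have "\<dots> = order G / 2 + card Z / 2"
      unfolding sum.distrib sum_indicator[OF centre_subset] by (simp add: order_def)
    finally show False
      using commuting_probability_eq card_subgroup_pos[OF subgroup_centre] by (simp add: P)
  qed
  then obtain u where u: "u \<in> carrier G" "u \<notin> ?E" by blast
  obtain j where j: "order G = j * card (centralizer u)" "2 \<le> j"
    using card_centralizer_decomp[of u] u by blast
  have j3: "3 \<le> j" using j u by (cases "j = 2") (auto simp: index_two_set_def)
  \<comment> \<open>For \<open>x \<in> D\<close>, the group \<open>C(x) \<inter> C(ux) \<subseteq> C(u)\<close> has index at most four, while
    \<open>C(u)\<close> has index at least three; hence they are equal and \<open>x\<close> commutes with \<open>u\<close>.\<close>
  define D where "D = {x \<in> ?E. u \<otimes> x \<in> ?E}"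
  have "D \<subseteq> centralizer u"
  proof
    fix x assume "x \<in> D"
    then have x: "x \<in> carrier G" "x \<in> ?E" "u \<otimes> x \<in> ?E" using E by (auto simp: D_def)
    have ux: "u \<otimes> x \<in> carrier G" using u x by simp
    let ?I = "centralizer x \<inter> centralizer (u \<otimes> x)"
    have I: "subgroup ?I G"
      using subgroup_Int subgroup_centralizer x(1) ux by blast
    have half: "order G \<le> 2 * card (centralizer y)" if "y \<in> ?E" for y
      using that mem_centre_iff_centralizer[of y] E by (auto simp: index_two_set_def order_def)
    have quarter: "order G \<le> 4 * card ?I"
    proof (cases "centralizer (u \<otimes> x) \<subseteq> centralizer x")
      case True
      then have "?I = centralizer (u \<otimes> x)" by blast
      then show ?thesis using half[OF x(3)] by simp
    next
      case False
      then have "x \<notin> Z" using mem_centre_iff_centralizer[OF x(1)] centralizer_subset by auto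
      then have "order G = 2 * card (centralizer x)" using x(2) by (auto simp: index_two_set_def)
      from card_Int_index_two[OF subgroup_centralizer[OF x(1)] this subgroup_centralizer[OF ux] False]
      have "card (centralizer (u \<otimes> x)) = 2 * card ?I" by (simp add: Int_commute)
      then show ?thesis using half[OF x(3)] by simp
    qed
    have sub: "?I \<subseteq> centralizer u"
    proof
      fix y assume "y \<in> ?I"
      then have y: "y \<in> carrier G" "x \<otimes> y = y \<otimes> x" "u \<otimes> x \<otimes> y = y \<otimes> (u \<otimes> x)"
        by (auto simp: mem_centralizer)
      have "(u \<otimes> y) \<otimes> x = (y \<otimes> u) \<otimes> x"
        using y u(1) x(1) by (simp add: m_assoc)
      then show "y \<in> centralizer u"
        using y(1) u(1) x(1) by (simp add: mem_centralizer)
    qed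
    have "?I = centralizer u"
    proof (rule ccontr)
      assume "?I \<noteq> centralizer u"
      then obtain t where t: "card (centralizer u) = t * card ?I" "2 \<le> t"
        using card_psubset_subgroup[OF subgroup_centralizer[OF u(1)] I] sub by blast
      have "6 \<le> j * t" using mult_le_mono[OF j3 t(2)] by simp
      then have "6 * card ?I \<le> order G"
        unfolding j(1) t(1) mult.assoc[symmetric] by (rule mult_le_mono1)
      then show False using quarter card_subgroup_pos[OF I] by simp
    qed
    then have "u \<in> centralizer x" using self_centralizer[OF u(1)] by blast
    then show "x \<in> centralizer u" using centralizer_sym x(1) by blast
  qed
  then have "card D \<le> card (centralizer u)"
    by (intro card_mono finite_subset_carrier centralizer_subset)
  then have D3: "3 * card D \<le> order G"
    using j(1) mult_le_mono[OF j3] by (metis le_trans mult_le_mono2)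
  \<comment> \<open>G is covered by the complement of \<open>?E\<close>, a translate of it and
    \<open>D\<close>. Hence |G| \<le> 6 |Z| + |G|/3, that is, |G| \<le> 9 |Z|.\<close>
  have "carrier G - ?E \<union> {x \<in> carrier G. u \<otimes> x \<notin> ?E} \<union> D = carrier G"
    using E by (auto simp: D_def)
  then have "order G \<le> card (carrier G - ?E \<union> {x \<in> carrier G. u \<otimes> x \<notin> ?E}) + card D"
    unfolding order_def by (metis card_Un_le)
  also have "\<dots> \<le> card (carrier G - ?E) + card {x \<in> carrier G. u \<otimes> x \<notin> ?E} + card D"
    by (intro add_right_mono card_Un_le)
  also have "card {x \<in> carrier G. u \<otimes> x \<notin> ?E} \<le> card (carrier G - ?E)"
  proof (rule card_inj_on_le[of "\<lambda>x. u \<otimes> x"])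
    show "inj_on (\<lambda>x. u \<otimes> x) {x \<in> carrier G. u \<otimes> x \<notin> ?E}"
      using u(1) by (auto intro!: inj_onI)
  qed (use u(1) in auto)
  finally have "order G \<le> 2 * card (carrier G - ?E) + card D" by simp
  moreover have "card (carrier G - ?E) \<le> 3 * card Z"
    using big card_Diff_subset[OF finE E] by (simp add: order_def)
  ultimately show ?thesis using D3 by simp
qed

end

section \<open>Groups whose non-central elements have abelian centralizers\<close>

context finite_group
begin

text \<open>If a and c both commute with a non-central b, they lie in the abelian group C(b) and
  commute, so non-adjacency is transitive.\<close>

lemma L_integral_abelian_centralizers:
  assumes "\<And>b. b \<in> carrier G - Z \<Longrightarrow> \<forall>y\<in>centralizer b. \<forall>y'\<in>centralizer b. y \<otimes> y' = y' \<otimes> y"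
  shows "L_integral (non_commuting_graph G)"
proof (rule L_integral_complete_multipartite)
  show "pair_graph (non_commuting_graph G)"
    by (rule pair_graph_non_commuting_graph) simp
  fix a b c
  assume "a \<in> pverts (non_commuting_graph G)" "b \<in> pverts (non_commuting_graph G)"
    "c \<in> pverts (non_commuting_graph G)" "(a, b) \<notin> parcs (non_commuting_graph G)"
    "(b, c) \<notin> parcs (non_commuting_graph G)"
  then have "b \<in> carrier G - Z" "a \<in> centralizer b" "c \<in> centralizer b"
    by (auto simp: non_commuting_graph_def mem_centralizer)
  then show "(a, c) \<notin> parcs (non_commuting_graph G)"
    using assms by (auto simp: non_commuting_graph_def)
qed

text \<open>Let H = C(x). A non-central b in H has C(b) = H, by maximality of H. For b outside H,
  elements of C(b) inside H are central, so every element of C(b) has the form z or zb with z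
  central.\<close>

lemma L_integral_abelian_index_two:
  assumes x: "x \<in> index_two_set"
    and ab: "\<And>y y'. \<lbrakk>y \<in> centralizer x; y' \<in> centralizer x\<rbrakk> \<Longrightarrow> y \<otimes> y' = y' \<otimes> y"
  shows "L_integral (non_commuting_graph G)"
proof (rule L_integral_abelian_centralizers, intro ballI)
  let ?H = "centralizer x"
  have xG: "x \<in> carrier G" and x2: "order G = 2 * card ?H"
    using x by (auto simp: index_two_set_def)
  note H = subgroup_centralizer[OF xG]
  fix b y y' assume b: "b \<in> carrier G - Z" and y: "y \<in> centralizer b" "y' \<in> centralizer b"
  have bG: "b \<in> carrier G" using b by simp
  show "y \<otimes> y' = y' \<otimes> y"
  proof (cases "b \<in> ?H")
    case True
    have "?H \<subseteq> centralizer b"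
      using ab[OF True] centralizer_subset by (auto simp: mem_centralizer)
    moreover have "centralizer b \<noteq> carrier G"
      using b mem_centre_iff_centralizer[OF bG] by blast
    ultimately have "centralizer b \<subseteq> ?H"
      using index_two_maximal[OF H x2 subgroup_centralizer[OF bG]] by blast
    then show ?thesis using ab y by blast
  next
    case False
    have *: "\<exists>z\<in>Z. y = z \<or> y = z \<otimes> b" if y: "y \<in> centralizer b" for y
    proof -
      have yG: "y \<in> carrier G" using y centralizer_subset by blast
      \<comment> \<open>Since H is abelian it equals the bicentre of x, and b is an element outside
        H commuting with a.\<close>
      have central: "a \<in> Z" if "a \<in> ?H" "a \<in> centralizer b" for a
        using bicentre_central[OF xG x2 _ bG False, of a] that ab
        by (auto simp: mem_bicentre mem_centralizer)
      show ?thesis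
      proof (cases "y \<in> ?H")
        case False
        have "inv b \<notin> ?H"
          using \<open>b \<notin> ?H\<close> bG subgroup.m_inv_closed[OF H] by (metis inv_inv)
        then have "y \<otimes> inv b \<in> ?H"
          using index_two_mult[OF H x2 yG False] bG by simp
        moreover have "y \<otimes> inv b \<in> centralizer b"
          using y self_centralizer[OF bG] subgroup_centralizer[OF bG]
          by (simp add: subgroup.m_closed subgroup.m_inv_closed)
        ultimately have "y \<otimes> inv b \<in> Z" by (rule central)
        then show ?thesis using yG bG by (intro bexI[of _ "y \<otimes> inv b"]) (auto simp: m_assoc)
      qed (use central y in blast)
    qed
    obtain z where z: "z \<in> Z" "y = z \<or> y = z \<otimes> b" using *[OF y(1)] by blast
    have "y \<in> carrier G" "y' \<in> carrier G" using y centralizer_subset by auto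
    moreover have "b \<otimes> y' = y' \<otimes> b" using y(2) by (simp add: mem_centralizer)
    moreover have "z \<in> carrier G" "z \<otimes> y' = y' \<otimes> z"
      using z(1) \<open>y' \<in> carrier G\<close> by (auto simp: mem_centre)
    ultimately show ?thesis using z(2) bG commute_mult[of y' z b] by auto
  qed
qed

text \<open>For non-central b the index [C(b) : Z] is a proper divisor 3 of 9. A non-abelian C(b)
  would have three strict steps between Z and itself, forcing this index to be at least 8.\<close>

lemma L_integral_centre_index_nine:
  assumes "order G = 9 * card Z"
  shows "L_integral (non_commuting_graph G)"
proof (rule L_integral_abelian_centralizers, rule ccontr)
  fix b assume "b \<in> carrier G - Z"
  then have b: "b \<in> carrier G" "b \<notin> Z" by auto
  assume nonab: "\<not> (\<forall>y\<in>centralizer b. \<forall>y'\<in>centralizer b. y \<otimes> y' = y' \<otimes> y)"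
  have Zpos: "0 < card Z" by (rule card_subgroup_pos[OF subgroup_centre])
  obtain s t where st: "card (centralizer b) = s * card Z" "order G = t * card (centralizer b)"
    "2 \<le> s" "2 \<le> t"
    using card_centralizer_decomp[OF b] .
  have "9 * card Z = t * s * card Z" using st(1,2) assms by (simp only: mult.assoc)
  then have "t * s = 9" using mult_right_cancel[OF less_not_refl2[OF Zpos]] by metis
  then have "s \<le> 4" using st(4) mult_le_mono[of 2 t s s] by simp
  then have "s = 2 \<or> s = 3 \<or> s = 4" using st(3) by auto
  then have s: "s = 3" using \<open>t * s = 9\<close> by presburger
  have "Z \<subset> bicentre b" using self_bicentre[OF b(1)] centre_subset_bicentre[OF b(1)] b by blast
  then obtain l where l: "card (bicentre b) = l * card Z" "2 \<le> l"
    using card_psubset_subgroup[OF subgroup_bicentre[OF b(1)] subgroup_centre] by blast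
  interpret H: finite_group "G\<lparr>carrier := centralizer b\<rparr>"
    by (rule finite_group_subgroup[OF subgroup_centralizer[OF b(1)]])
  obtain y where y: "y \<in> centralizer b" "y \<notin> bicentre b"
    using nonab by (auto simp: mem_bicentre)
  obtain c d where cd: "card (H.centralizer y) = c * card (bicentre b)"
    "card (centralizer b) = d * card (H.centralizer y)" "2 \<le> c" "2 \<le> d"
    using H.card_centralizer_decomp[of y] y by (auto simp: bicentre_def order_def)
  have "3 * card Z = d * c * l * card Z" using cd(1,2) st(1) s l(1) by (simp only: mult.assoc)
  then have "d * c * l = 3" using mult_right_cancel[OF less_not_refl2[OF Zpos]] by metis
  moreover have "2 * 2 * 2 \<le> d * c * l" using cd l by (intro mult_le_mono) auto
  ultimately show False by simp
qed

end

section \<open>Excluding the remaining groups\<close>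

context finite_group
begin

text \<open>Without weight 1/2, every value above 1/3 bounds n = [G : Z]. Integrality of Pr(G) n^2
  then leaves few candidates, and those not divisible by 3 fail the sharper bound with 1/4.\<close>

lemma order_eq_if_index_two_set_empty:
  assumes P: "commuting_probability G \<in> {5/14, 2/5, 11/27, 1/2, 5/8}"
    and nonab: "Z \<noteq> carrier G" and I: "index_two_set = {}"
  shows "order G = 9 * card Z"
proof -
  let ?P = "commuting_probability G"
  have Zpos: "0 < card Z" by (rule card_subgroup_pos[OF subgroup_centre])
  obtain x where x: "x \<in> carrier G" "x \<notin> Z" using nonab centre_subset by blast
  obtain a b where ab: "card (centralizer x) = a * card Z" "order G = b * card (centralizer x)"
    "2 \<le> a" "2 \<le> b"
    using card_centralizer_decomp[OF x] .
  define n where "n = b * a"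
  have n: "order G = n * card Z" using ab(1,2) by (simp add: n_def)
  have b2: "b \<noteq> 2" using I ab(2) x(1) by (auto simp: index_two_set_def)
  \<comment> \<open>C(x) has index at least 3 in G and contains Z with index at least 2.\<close>
  have n_ge: "6 \<le> n" using mult_le_mono[of 3 b 2 a] ab(3,4) b2 by (simp add: n_def)
  have "?P * n * card Z \<le> (n / 3 + 2 / 3) * card Z"
    using probability_le_index_two unfolding I n by (simp add: field_simps)
  then have bound: "?P * n \<le> n / 3 + 2 / 3"
    using Zpos by (simp add: mult_le_cancel_right)
  \<comment> \<open>The index of any centralizer divides n, so index three cannot occur
    here.\<close>
  have bound4: "?P * n \<le> n / 4 + 3 / 4" if "\<not> 3 dvd n"
  proof -
    have "order G \<noteq> 3 * card (centralizer y)" if y: "y \<in> carrier G" for y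
    proof
      assume *: "order G = 3 * card (centralizer y)"
      obtain c where "card (centralizer y) = card Z * c"
        using card_subgroup_dvd[OF subgroup_centralizer[OF y] subgroup_centre
            centre_subset_centralizer[OF y]] by blast
      then have "n * card Z = 3 * c * card Z" using * n by auto
      then have "n = 3 * c" using mult_right_cancel[OF less_not_refl2[OF Zpos]] by metis
      then show False using \<open>\<not> 3 dvd n\<close> by simp
    qed
    then have "?P * n * card Z \<le> (n / 4 + 3 / 4) * card Z"
      using probability_le_index_four[OF I] unfolding n by (simp add: field_simps)
    then show ?thesis using Zpos by (simp add: mult_le_cancel_right)
  qed
  obtain K :: nat where K: "?P * n\<^sup>2 = K"
  proof -
    obtain K :: nat where "?P * (order G)\<^sup>2 = K * (card Z)\<^sup>2" by (rule probability_integral)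
    then have "?P * n\<^sup>2 * (card Z)\<^sup>2 = K * (card Z)\<^sup>2" unfolding n by (simp add: power_mult_distrib)
    then show thesis using that Zpos by simp
  qed
  have "n = 9"
    using P
  proof (elim insertE emptyE)
    assume "?P = 5/14"
    \<comment> \<open>5/14 - 1/3 = 1/42 and 42 * 2/3 = 28. The limits 10 and 9 below arise likewise
      from 2/5 - 1/3 = 1/15 and 11/27 - 1/3 = 2/27.\<close>
    then have "n \<le> 28" using bound by (simp only:)
    have "real (5 * n\<^sup>2) = real (14 * K)" using K unfolding \<open>?P = 5/14\<close> by simp
    then have "5 * n\<^sup>2 = 14 * K" by (simp only: of_nat_eq_iff)
    then have "7 dvd 5 * n\<^sup>2" "2 dvd 5 * n\<^sup>2" by simp_all
    then have "7 dvd n" "2 dvd n"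
      by (simp_all add: prime_dvd_mult_iff prime_dvd_power_iff)
    then have "n = 14 \<or> n = 28" using \<open>n \<le> 28\<close> n_ge by presburger
    \<comment> \<open>Neither 14 nor 28 is divisible by 3, and \<open>bound4\<close> would give 5
      \<le> 17/4 or 10 \<le> 31/4.\<close>
    then show ?thesis using bound4 unfolding \<open>?P = 5/14\<close> by auto
  next
    assume "?P = 2/5"
    then have "n \<le> 10" using bound by (simp only:)
    have "real (2 * n\<^sup>2) = real (5 * K)" using K unfolding \<open>?P = 2/5\<close> by simp
    then have "2 * n\<^sup>2 = 5 * K" by (simp only: of_nat_eq_iff)
    then have "5 dvd 2 * n\<^sup>2" by simp
    then have "5 dvd n" by (simp add: prime_dvd_mult_iff prime_dvd_power_iff)
    then have "n = 10" using \<open>n \<le> 10\<close> n_ge by presburger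
    then show ?thesis using bound4 unfolding \<open>?P = 2/5\<close> by auto
  next
    assume "?P = 11/27"
    then have "n \<le> 9" using bound by (simp only:)
    have "real (11 * n\<^sup>2) = real (27 * K)" using K unfolding \<open>?P = 11/27\<close> by simp
    then have *: "11 * n\<^sup>2 = 27 * K" by (simp only: of_nat_eq_iff)
    have "n \<in> {6, 7, 8, 9}" using \<open>n \<le> 9\<close> n_ge by auto
    then show ?thesis using * by (elim insertE emptyE; simp; presburger)
  next
    assume "?P = 1/2"
    \<comment> \<open>The bound would give n \<le> 4.\<close>
    then show ?thesis using bound n_ge by (simp only:)
  next
    assume "?P = 5/8"
    then show ?thesis using bound n_ge by (simp only:)
  qed
  then show ?thesis using n by simp
qed

section \<open>All centralizers of index two non-abelian\<close>

context
  fixes x0 :: 'a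
  assumes x0: "x0 \<in> index_two_set"
    and nonab: "\<And>x. x \<in> index_two_set \<Longrightarrow>
      \<exists>y\<in>centralizer x. \<exists>y'\<in>centralizer x. y \<otimes> y' \<noteq> y' \<otimes> y"
begin

text \<open>The four strict steps of the chain from Z to G each contribute a factor of at least
  2.\<close>

lemma order_ge_sixteen: "16 * card Z \<le> order G"
proof -
  obtain m a b where *: "order G = 2 * (a * b) * m * card Z" "2 \<le> m" "2 \<le> a" "2 \<le> b"
    using bicentre_decomp[OF x0 nonab[OF x0]] by metis
  then have "2 * (2 * 2) * 2 \<le> 2 * (a * b) * m" by (intro mult_le_mono) auto
  then show ?thesis unfolding *(1) using mult_le_mono1 by fastforce
qed

text \<open>Since |G| \<ge> 8 m |Z|, the central term is at most |G|/(16 m), and m > k gives Pr(G)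
  \<le> 1/4 + 9/(16 (k + 1)). This is 25/64 < 2/5 for k = 3 and 11/32 < 5/14 for k = 5.\<close>

lemma bicentre_card_le:
  assumes x: "x \<in> index_two_set"
    and bnd: "k = 3 \<and> 2/5 \<le> commuting_probability G \<or> k = 5 \<and> 5/14 \<le> commuting_probability G"
  obtains m a b where "card (bicentre x) = m * card Z" "order G = 2 * (a * b) * m * card Z"
    "2 \<le> m" "m \<le> k" "2 \<le> a" "2 \<le> b"
proof -
  obtain m a b where *: "card (bicentre x) = m * card Z" "order G = 2 * (a * b) * m * card Z"
    "2 \<le> m" "2 \<le> a" "2 \<le> b"
    using bicentre_decomp[OF x nonab[OF x]] .
  have "m \<le> k"
  proof (rule ccontr)
    assume "\<not> m \<le> k"
    then have m: "k + 1 \<le> m" by simp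
    have "2 * (2 * 2) * m \<le> 2 * (a * b) * m" using * by (intro mult_le_mono) auto
    then have "8 * (m * card Z) \<le> order G" unfolding *(2) using mult_le_mono1 by fastforce
    then have "8 * (real m * card Z) \<le> order G" by (metis of_nat_le_iff of_nat_mult of_nat_numeral)
    then have 1: "card Z / 2 \<le> order G / (16 * m)" using * by (simp add: field_simps)
    have "real (order G) / (2 * m) + order G / (16 * m) = 9 / 16 * (order G / m)"
      using *(3) by (simp add: field_simps)
    also have "\<dots> \<le> 9 / 16 * (order G / (k + 1))"
      using m by (intro mult_left_mono divide_left_mono) auto
    finally have "commuting_probability G * order G \<le> order G / 4 + 9 / 16 * (order G / (k + 1))"
      using probability_le_bicentre[OF x *(1)] *(3) 1 by simp
    also have "\<dots> = (1 / 4 + 9 / 16 / (k + 1)) * order G" by (simp add: field_simps)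
    finally have "commuting_probability G \<le> 1 / 4 + 9 / 16 / (k + 1)"
      using order_pos by (simp add: mult_le_cancel_right)
    then show False using bnd by auto
  qed
  with that * show thesis by blast
qed

text \<open>The m-th power of e is central for m the index of Z in the bicentre of e; taking r a
  common multiple of 2, ..., k gives one exponent for all e.\<close>

lemma index_two_pow_central:
  assumes bnd: "k = 3 \<and> 2/5 \<le> commuting_probability G \<or> k = 5 \<and> 5/14 \<le> commuting_probability G"
    and "\<And>m. \<lbrakk>2 \<le> m; m \<le> k\<rbrakk> \<Longrightarrow> m dvd r" and e: "e \<in> Z \<union> index_two_set"
  shows "e [^] (r::nat) \<in> Z"
proof (cases "e \<in> Z")
  case True
  then show ?thesis using subgroup_centre by (induction r) (auto simp: subgroup.one_closed subgroup.m_closed)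
next
  case False
  then have e: "e \<in> index_two_set" using e by simp
  then have eG: "e \<in> carrier G" using index_two_set_subset by blast
  obtain m where m: "card (bicentre e) = m * card Z" "2 \<le> m" "m \<le> k"
    using bicentre_card_le[OF e bnd] by metis
  have "e [^] m \<in> Z" by (rule bicentre_pow_central[OF eG m(1) self_bicentre[OF eG]])
  moreover obtain s where "r = m * s" using assms(2)[OF m(2,3)] ..
  moreover have "z [^] s \<in> Z" if "z \<in> Z" for z and s :: nat
    using that subgroup_centre by (induction s) (auto simp: subgroup.one_closed subgroup.m_closed)
  ultimately show ?thesis using eG by (simp flip: nat_pow_pow)
qed

lemma commute_mod_centre_index_two:
  "\<lbrakk>e \<in> Z \<union> index_two_set; f \<in> Z \<union> index_two_set\<rbrakk> \<Longrightarrow> \<exists>c\<in>Z. e \<otimes> f = c \<otimes> (f \<otimes> e)"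
  using centre_subset by (intro commute_mod_centre) (auto simp: index_two_set_def)

text \<open>With n = [G : Z], integrality of (r/s) n^2 and coprimality give s | n^2; d is what this
  forces to divide n, such as 9 for s = 27.\<close>

lemma order_dvd:
  fixes r s d :: nat
  assumes "commuting_probability G = r / s" "coprime r s" "0 < s" and "\<And>n. s dvd n\<^sup>2 \<Longrightarrow> d dvd n"
  shows "d * card Z dvd order G"
proof -
  obtain n where n: "order G = n * card Z"
    using card_subgroup_dvd_order[OF subgroup_centre] by (metis dvdE mult.commute)
  obtain K :: nat where "commuting_probability G * (order G)\<^sup>2 = K * (card Z)\<^sup>2"
    by (rule probability_integral)
  then have "(real r / real s * (real n)\<^sup>2) * (real (card Z))\<^sup>2 = real K * (real (card Z))\<^sup>2"
    unfolding n assms(1) by (simp add: power_mult_distrib)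
  moreover have "(real (card Z))\<^sup>2 \<noteq> 0"
    using card_subgroup_pos[OF subgroup_centre] by simp
  ultimately have "real r / real s * (real n)\<^sup>2 = real K"
    using mult_right_cancel by blast
  then have "real (r * n\<^sup>2) = real (s * K)" using assms(3) by (simp add: field_simps)
  then have "r * n\<^sup>2 = s * K" by (simp only: of_nat_eq_iff)
  then have "s dvd r * n\<^sup>2" by simp
  then have "s dvd n\<^sup>2" using assms(2) by (simp add: coprime_commute coprime_dvd_mult_right_iff)
  then show ?thesis using assms(4) n by simp
qed

text \<open>Here 5 divides [G : Z] and is coprime to 6, the common multiple of the possible bicentre
  indices 2 and 3, so at most a fifth of G lies in \<open>?E\<close>.\<close>

lemma probability_ne_two_fifths: "commuting_probability G \<noteq> 2 / 5"
proof
  assume P: "commuting_probability G = 2 / 5"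
  let ?E = "Z \<union> index_two_set"
  have "5 * card Z dvd order G"
    by (rule order_dvd[of 2 5]) (use P in \<open>auto simp: prime_dvd_power_iff\<close>)
  moreover have "e [^] (6::nat) \<in> Z" if "e \<in> ?E" for e
  proof (rule index_two_pow_central[OF _ _ that, of 3])
    fix m :: nat assume "2 \<le> m" "m \<le> 3"
    then have "m = 2 \<or> m = 3" by auto
    then show "m dvd 6" by auto
  qed (simp add: P)
  ultimately have "5 * card ?E \<le> order G"
    using centre_subset index_two_set_subset commute_mod_centre_index_two
    by (intro commuting_exponent_bound_mod[OF normal_centre, where k = 6]) (auto simp: coprime_iff_gcd_eq_1 gcd_non_0_nat)
  \<comment> \<open>1/3 + 1/30 + 1/32 = 191/480 < 192/480 = 2/5.\<close>
  then show False
    using probability_le_index_two order_ge_sixteen order_pos unfolding P by simp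
qed

text \<open>Now 9 divides [G : Z] but is not coprime to 6, so only the elements \<open>S\<close> of
  \<open>?E\<close> with central square are bounded through the exponent. The others have bicentre
  index 3 and are handled through their centralizers.\<close>

lemma probability_ne_eleven_27ths: "commuting_probability G \<noteq> 11 / 27"
proof
  assume P: "commuting_probability G = 11 / 27"
  let ?E = "Z \<union> index_two_set"
  define S where "S = {e \<in> ?E. e [^] (2::nat) \<in> Z}"
  have finE: "finite ?E"
    using centre_subset index_two_set_subset by (intro finite_subset_carrier) auto
  have finS: "finite S" using finE by (simp add: S_def)
  have "9 dvd n" if "27 dvd n\<^sup>2" for n :: nat
  proof -
    have "3 dvd n\<^sup>2" using that by (rule dvd_trans[rotated]) simp
    then obtain t where t: "n = 3 * t" by (auto simp: prime_dvd_power_iff)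
    then have "9 * 3 dvd 9 * t\<^sup>2" using that by (simp add: power_mult_distrib)
    then have "3 dvd t\<^sup>2" by simp
    then have "3 dvd t" by (simp add: prime_dvd_power_iff)
    then show ?thesis unfolding t by auto
  qed
  then have "9 * card Z dvd order G"
    by (intro order_dvd[of 11 27]) (use P in \<open>auto simp: coprime_iff_gcd_eq_1 gcd_non_0_nat\<close>)
  then have S: "9 * card S \<le> order G"
    using centre_subset index_two_set_subset commute_mod_centre_index_two
    by (intro commuting_exponent_bound_mod[OF normal_centre, where k = 2])
      (auto simp: coprime_iff_gcd_eq_1 gcd_non_0_nat S_def)
  have Z_S: "Z \<subseteq> S"
    using subgroup.m_closed[OF subgroup_centre] centre_subset by (auto simp: S_def numeral_2_eq_2)
  \<comment> \<open>Index 2 would put x into \<open>S\<close>, so the bicentre has index 3 over Z. A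
    member of \<open>?E\<close> outside C(x) would then have a centralizer whose index 2 is
    divisible by 3.\<close>
  have three: "8 * card (bicentre x) \<le> order G" "?E \<subseteq> centralizer x"
    if x: "x \<in> index_two_set" "x \<notin> S" for x
  proof -
    have xG: "x \<in> carrier G" using x index_two_set_subset by blast
    obtain m a b where m: "card (bicentre x) = m * card Z" "order G = 2 * (a * b) * m * card Z"
      "2 \<le> m" "m \<le> 3" "2 \<le> a" "2 \<le> b"
      by (rule bicentre_card_le[OF x(1), of 3]) (simp add: P)
    have "m \<noteq> 2"
      using bicentre_pow_central[OF xG m(1) self_bicentre[OF xG]] x by (auto simp: S_def)
    then have c: "card (bicentre x) = 3 * card Z" using m by simp
    have "2 * (2 * 2) * (m * card Z) \<le> 2 * (a * b) * (m * card Z)"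
      using m by (intro mult_le_mono) auto
    then show "8 * card (bicentre x) \<le> order G" unfolding m(1,2) by (simp add: mult.assoc)
    show "?E \<subseteq> centralizer x"
    proof
      fix g assume g: "g \<in> ?E"
      then have gG: "g \<in> carrier G" using centre_subset index_two_set_subset by blast
      show "g \<in> centralizer x"
      proof (rule ccontr)
        assume out: "g \<notin> centralizer x"
        then have "g \<in> index_two_set" using g centre_subset_centralizer[OF xG] by blast
        then have "order G = 2 * card (centralizer g)" by (simp add: index_two_set_def)
        moreover obtain l where "order G = l * 3 * card (centralizer g)"
          using index_outside_ge[OF x(1) c gG out] .
        ultimately have "l * 3 * card (centralizer g) = 2 * card (centralizer g)" by simp
        then have "l * 3 = 2"
          using card_subgroup_pos[OF subgroup_centralizer[OF gG]] mult_right_cancel less_not_refl2 by metis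
        then show False by presburger
      qed
    qed
  qed
  \<comment> \<open>Two distinct centralizers from outside \<open>S\<close> both contain
    \<open>?E\<close> and meet in a subgroup of index 4. If there is only one, \<open>?E\<close>
    lies in \<open>S\<close> united with a single bicentre, of size at most (1/9 + 1/8) |G|.\<close>
  have "4 * card ?E \<le> order G"
  proof (cases "\<exists>x\<in>?E - S. \<exists>y\<in>?E - S. centralizer x \<noteq> centralizer y")
    case True
    then obtain x y where xy: "x \<in> index_two_set" "x \<notin> S" "y \<in> index_two_set" "y \<notin> S"
      "centralizer x \<noteq> centralizer y"
      using Z_S by blast
    then have xG: "x \<in> carrier G" "order G = 2 * card (centralizer x)"
      and yG: "y \<in> carrier G" "order G = 2 * card (centralizer y)"
      by (auto simp: index_two_set_def)
    have "\<not> centralizer y \<subseteq> centralizer x"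
      using xy(5) xG(2) yG(2) card_subset_eq[OF finite_subset_carrier[OF centralizer_subset], of "centralizer y" x]
      by auto
    from card_Int_index_two[OF subgroup_centralizer[OF xG(1)] xG(2) subgroup_centralizer[OF yG(1)] this]
    have "order G = 4 * card (centralizer y \<inter> centralizer x)" using yG(2) by simp
    moreover have "card ?E \<le> card (centralizer y \<inter> centralizer x)"
      using three(2)[OF xy(1,2)] three(2)[OF xy(3,4)] centralizer_subset
      by (intro card_mono finite_subset_carrier) auto
    ultimately show ?thesis by simp
  next
    case False
    show ?thesis
    proof (cases "?E \<subseteq> S")
      case True
      then have "card ?E \<le> card S" by (rule card_mono[OF finS])
      then show ?thesis using S by simp
    next
      case nonempty: False
      then obtain x where x: "x \<in> ?E" "x \<notin> S" by blast
      have "?E \<subseteq> S \<union> bicentre x"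
      proof
        fix y assume y: "y \<in> ?E"
        show "y \<in> S \<union> bicentre x"
        proof (cases "y \<in> S")
          case False
          then have "centralizer x = centralizer y" using \<open>\<not> (\<exists>x\<in>?E - S. _ x)\<close> x y by blast
          then have "bicentre x = bicentre y" by (simp add: bicentre_def)
          moreover have "y \<in> carrier G" using y centre_subset index_two_set_subset by blast
          ultimately show ?thesis using self_bicentre by blast
        qed simp
      qed
      then have "card ?E \<le> card (S \<union> bicentre x)"
        using finite_subset_carrier[OF bicentre_subset] finS by (intro card_mono) auto
      also have "\<dots> \<le> card S + card (bicentre x)" by (rule card_Un_le)
      finally show ?thesis using S three(1)[of x] x Z_S by auto
    qed
  qed
  \<comment> \<open>1/3 + 1/24 + 1/32 = 13/32, just below 11/27.\<close>
  then show False
    using probability_le_index_two order_ge_sixteen order_pos unfolding P by simp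
qed

text \<open>Since 14 divides [G : Z], \<open>?E\<close> is small: at most |G|/7 via exponent 60, the
  least common multiple of 2, ..., 5, and at most |G|/14 via exponent 3 if every bicentre index is
  3. The first case compensates with the bound for m \<noteq> 3.\<close>

lemma probability_ne_five_14ths: "commuting_probability G \<noteq> 5 / 14"
proof
  assume P: "commuting_probability G = 5 / 14"
  let ?E = "Z \<union> index_two_set"
  have E: "?E \<subseteq> carrier G" using centre_subset index_two_set_subset by blast
  have Zpos: "0 < card Z" by (rule card_subgroup_pos[OF subgroup_centre])
  have dvd: "14 * card Z dvd order G"
  proof (rule order_dvd[of 5 14])
    fix n :: nat assume 14: "14 dvd n\<^sup>2"
    have "2 dvd n\<^sup>2" "7 dvd n\<^sup>2" by (rule dvd_trans[OF _ 14], simp)+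
    then have "2 dvd n" "7 dvd n" by (simp_all add: prime_dvd_power_iff)
    then show "14 dvd n" by presburger
  qed (use P in \<open>auto simp: coprime_iff_gcd_eq_1 gcd_non_0_nat\<close>)
  show False
  proof (cases "\<exists>x\<in>index_two_set. card (bicentre x) \<noteq> 3 * card Z")
    case True
    then obtain x where x: "x \<in> index_two_set" "card (bicentre x) \<noteq> 3 * card Z" by blast
    obtain m where m: "card (bicentre x) = m * card Z" "2 \<le> m"
      using bicentre_decomp[OF x(1) nonab[OF x(1)]] by metis
    then have "m \<noteq> 3" using x by auto
    have "e [^] (60::nat) \<in> Z" if "e \<in> ?E" for e
    proof (rule index_two_pow_central[OF _ _ that, of 5])
      fix m :: nat assume "2 \<le> m" "m \<le> 5"
      then have "m = 2 \<or> m = 3 \<or> m = 4 \<or> m = 5" by auto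
      then show "m dvd 60" by auto
    qed (simp add: P)
    moreover have "7 * card Z dvd order G"
      using dvd by (rule dvd_trans[rotated]) (simp add: mult_dvd_mono)
    ultimately have 7: "7 * card ?E \<le> order G"
      using E commute_mod_centre_index_two
      by (intro commuting_exponent_bound_mod[OF normal_centre, where k = 60]) (auto simp: coprime_iff_gcd_eq_1 gcd_non_0_nat)
    \<comment> \<open>A multiple of 14 that is at least 16 is at least 28.\<close>
    obtain t where t: "order G = 14 * card Z * t" using dvd ..
    have "16 * card Z \<le> 14 * card Z * t" using order_ge_sixteen t by simp
    then have "t \<noteq> 0" "t \<noteq> 1" using Zpos by auto
    then have "28 * card Z \<le> order G" unfolding t by simp
    \<comment> \<open>7/24 + 1/28 + 1/56 = 58/168 < 60/168 = 5/14.\<close>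
    then show False
      using probability_le_bicentre_not_three[OF x(1) m \<open>m \<noteq> 3\<close>] 7 order_pos unfolding P by simp
  next
    case False
    obtain m a b where m: "card (bicentre x0) = m * card Z" "order G = 2 * (a * b) * m * card Z"
      "2 \<le> a" "2 \<le> b"
      using bicentre_decomp[OF x0 nonab[OF x0]] by metis
    have "m * card Z = 3 * card Z" using False x0 m(1) by auto
    then have m3: "m = 3" using Zpos by simp
    have "e [^] (3::nat) \<in> Z" if e: "e \<in> ?E" for e
    proof (cases "e \<in> Z")
      case True
      then show ?thesis using subgroup.m_closed[OF subgroup_centre] centre_subset
        by (auto simp: numeral_3_eq_3)
    next
      case notZ: False
      then have "e \<in> carrier G" "card (bicentre e) = 3 * card Z" using False e E by auto
      then show ?thesis using bicentre_pow_central self_bicentre by blast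
    qed
    then have 14: "14 * card ?E \<le> order G"
      using E commute_mod_centre_index_two dvd
      by (intro commuting_exponent_bound_mod[OF normal_centre, where k = 3]) (auto simp: coprime_iff_gcd_eq_1 gcd_non_0_nat)
    have "14 * card Z dvd (6 * (a * b)) * card Z" using dvd m(2) m3 by simp
    then have "14 dvd 6 * (a * b)" using Zpos by simp
    then have "7 dvd a * b" by presburger
    \<comment> \<open>7 is prime and both factors exceed 1, so the multiple ab of 7 is at least 14
      and [G : Z] = 6ab is at least 84.\<close>
    moreover have "a * b \<noteq> 7"
      using prime_product[of a b] m(3,4) by auto
    moreover have "0 < a * b" using m(3,4) by simp
    ultimately have "14 \<le> a * b" by presburger
    then have "84 * card Z \<le> order G" unfolding m(2) m3 by simp
    \<comment> \<open>1/3 + 1/84 + 1/168 = 59/168 < 60/168.\<close>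
    then show False
      using probability_le_index_two 14 Zpos order_pos unfolding P by simp
  qed
qed

lemma probability_not_exceptional:
  "commuting_probability G \<notin> {5/14, 2/5, 11/27, 1/2, 5/8}"
proof -
  have "commuting_probability G \<noteq> 1 / 2"
    using order_le_if_probability_half order_ge_sixteen card_subgroup_pos[OF subgroup_centre] by auto
  moreover have "commuting_probability G \<noteq> 5 / 8"
  proof
    assume P: "commuting_probability G = 5 / 8"
    \<comment> \<open>With [G : Z] \<ge> 16 the bound is at most 1/2 + 1/32.\<close>
    show False
      using probability_le_centre order_ge_sixteen order_pos unfolding P by simp
  qed
  ultimately show ?thesis
    using probability_ne_two_fifths probability_ne_eleven_27ths probability_ne_five_14ths by simp
qed

end

end

theorem proposition5p5:
  fixes G :: "('a, 'b) monoid_scheme"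
  assumes "group G"
    and "finite (carrier G)"
    and "commuting_probability G \<in> {5/14, 2/5, 11/27, 1/2, 5/8}"
  shows "L_integral (non_commuting_graph G)"
proof -
  interpret finite_group G
    using assms by (simp add: finite_group_def finite_group_axioms_def)
  show ?thesis
  proof (cases "Z = carrier G")
    case True
    \<comment> \<open>An abelian group has no non-central elements, so the condition on centralizers
      is vacuous.\<close>
    then show ?thesis by (intro L_integral_abelian_centralizers) auto
  next
    case False
    \<comment> \<open>If centralizers of index two existed and all were non-abelian, none of the
      five values could occur.\<close>
    consider "index_two_set = {}" | x where "x \<in> index_two_set"
      "\<And>y y'. \<lbrakk>y \<in> centralizer x; y' \<in> centralizer x\<rbrakk> \<Longrightarrow> y \<otimes>\<^bsub>G\<^esub> y' = y' \<otimes>\<^bsub>G\<^esub> y"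
      using probability_not_exceptional assms(3) by blast
    then show ?thesis
    proof cases
      case 1
      then show ?thesis
        using L_integral_centre_index_nine order_eq_if_index_two_set_empty[OF assms(3) False] by blast
    next
      case 2
      then show ?thesis by (rule L_integral_abelian_index_two)
    qed
  qed
qed

end
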